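(* Let $f:\mathbb R\to\mathbb R$ be an odd function, not identically zero, equal to its Taylor series at $0$, with derivatives at zero bounded ($\sup_k|f^{(k)}(0)|<\infty$). For odd $k\ge1$ let $F_k(x)=\sum_{u\ge0}\frac{f^{(2u+k)}(0)}{u!}x^u$, and let $$\kappa=\sum_{k\ \mathrm{odd}}\frac{F_k(1/2)^2}{k!},\qquad \lambda=F_1(1/2)^2 .$$ Let $X\sim\mathcal N(0,\Sigma_\rho)$ in $\mathbb R^d$ have precision matrix $\Sigma_\rho^{-1}=I+B$, where $B$ is symmetric with $B_{ii}=0$ for all $i$ and operator norm $\|B\|\le\delta<1$, and put $\epsilon=\frac{\delta}{1-\delta}$. Let $\tau$ be the covariance matrix of $Y=(f(X_1),\dots,f(X_d))$. Suppose $d\epsilon$ is bounded. Then the precision matrix of $Y$ has the form $$\tau^{-1}=\frac1\kappa I+\frac{\lambda}{\kappa^2}B+\frac1\kappa E'',$$ where the off-diagonal entries of $E''$ are $O(\epsilon^2)$ as $\epsilon\to0$. In particular, for $i\ne j$ with $B_{ij}=0$ one has $(\tau^{-1})_{ij}=O(\epsilon^2)$, while for $i\neq j$ with $B_{ij}\neq0$ the first-order term of $(\tau^{-1})_{ij}$ is $\frac{\lambda}{\kappa^2}B_{ij}$.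
   Context: $\tau_{ij}=\mathbb E[f(X_i)f(X_j)]$ (the mean of $Y$ is zero since $f$ is odd). The $O(\epsilon^2)$ convention: for every $K>0$ there are constants $C,\epsilon_0>0$ depending only on $f$ and $K$ such that, whenever $d\epsilon\le K$ and $\epsilon\le\epsilon_0$, the matrix $\tau$ is invertible and the error is at most $C\epsilon^2$ in absolute value, uniformly over $d$, $B$ and $i\ne j$. *)

theory Defs
  imports
    "HOL-Probability.Probability"
    "Jordan_Normal_Form.Gauss_Jordan_Elimination"
    "Jordan_Normal_Form.Determinant"
begin

text \<open>
  The dimension \<open>d\<close> has to be quantified after the constants of the \<open>O(\<epsilon>\<^sup>2)\<close> bound, so it cannot
  be a type. Vectors and matrices are therefore those of Jordan_Normal_Form, with indices
  \<open>0, \<dots>, d - 1\<close>, and a point of \<open>\<real>\<^sup>d\<close> as a sample is an element of the product space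
  \<open>\<Pi>\<^sub>M i\<in>{..<d}. lborel\<close>.
\<close>

definition euclid_norm :: "real vec \<Rightarrow> real" where
  "euclid_norm v = L2_set (vec_index v) {..<dim_vec v}"

definition op_norm :: "real mat \<Rightarrow> real" where
  "op_norm A =
     (SUP v \<in> {v \<in> carrier_vec (dim_col A). euclid_norm v \<le> 1}. euclid_norm (A *\<^sub>v v))"

text \<open>
  For nonsingular \<open>S\<close>, \<open>mat_inverse S = Some P\<close> says that \<open>P\<close> is the two-sided inverse of \<open>S\<close>;
  for singular \<open>S\<close> the value is \<open>None\<close>. The density below is only meant for symmetric positive
  definite \<open>S\<close>.
\<close>

definition gaussian_density :: "nat \<Rightarrow> real mat \<Rightarrow> (nat \<Rightarrow> real) \<Rightarrow> real" where
  "gaussian_density d S x =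
     exp (- (scalar_prod (vec d x) (the (mat_inverse S) *\<^sub>v vec d x)) / 2)
       / sqrt ((2 * pi) ^ d * Determinant.det S)"

text \<open>The law \<open>\<N>(0, S)\<close> on \<open>\<real>\<^sup>d\<close>.\<close>

definition gaussian :: "nat \<Rightarrow> real mat \<Rightarrow> (nat \<Rightarrow> real) measure" where
  "gaussian d S =
     density (\<Pi>\<^sub>M i\<in>{..<d}. lborel) (\<lambda>x. ennreal (gaussian_density d S x))"

text \<open>
  The matrix \<open>\<tau>\<^sub>i\<^sub>j = \<bbbE>[f(X\<^sub>i) f(X\<^sub>j)]\<close> for \<open>X \<sim> \<N>(0, S)\<close>, which is the covariance matrix of
  \<open>(f(X\<^sub>1), \<dots>, f(X\<^sub>d))\<close> because that vector has mean zero for odd \<open>f\<close>. It depends only on the law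
  of \<open>X\<close>, so \<open>X\<close> is taken to be the identity on \<open>gaussian d S\<close>.
\<close>

definition tau :: "(real \<Rightarrow> real) \<Rightarrow> nat \<Rightarrow> real mat \<Rightarrow> real mat" where
  "tau f d S = mat d d (\<lambda>(i, j). \<integral>x. f (x i) * f (x j) \<partial>gaussian d S)"

abbreviation deriv0 :: "(real \<Rightarrow> real) \<Rightarrow> nat \<Rightarrow> real" where
  "deriv0 f k \<equiv> (deriv ^^ k) f 0"

definition F :: "(real \<Rightarrow> real) \<Rightarrow> nat \<Rightarrow> real \<Rightarrow> real" where
  "F f k x = (\<Sum>u. deriv0 f (2 * u + k) / fact u * x ^ u)"

definition kappa :: "(real \<Rightarrow> real) \<Rightarrow> real" where
  "kappa f = (\<Sum>m. (F f (2 * m + 1) (1 / 2))\<^sup>2 / fact (2 * m + 1))"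

definition lam :: "(real \<Rightarrow> real) \<Rightarrow> real" where
  "lam f = (F f 1 (1 / 2))\<^sup>2"

end

theory Submission
  imports Defs "HOL-Complex_Analysis.Cauchy_Integral_Formula"
begin

text \<open>
  The entries of \<open>\<tau>\<close> have an exact expansion. For a centred Gaussian pair \<open>(X, Y)\<close> with variances
  \<open>a\<close>, \<open>b\<close> and covariance \<open>c\<close>,
  \<open>E[f(X) f(Y)] = (\<Sum>m. c ^ m / fact m * F f m (a / 2) * F f m (b / 2))\<close> (\<open>expectation_pair\<close>).
  The reason is that \<open>E[f(X) f(Y)]\<close> arises from the power series of the moment generating function
  \<open>exp (a / 2 * s\<^sup>2 + c * s * t + b / 2 * t\<^sup>2)\<close> by substituting \<open>deriv0 f k\<close> for \<open>s ^ k\<close> and for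
  \<open>t ^ k\<close>. The argument uses only this generating function, which the Gaussian integral
  \<open>nn_integral_exp_quadratic_form\<close> provides for any two coordinates of \<open>\<N>(0, S)\<close>, equal or not; no
  marginal density is computed.

  Since \<open>B\<close> has zero diagonal, \<open>S = (I + B)\<^sup>-\<^sup>1\<close> has diagonal entries \<open>1 + O(\<epsilon>\<^sup>2)\<close> and
  off-diagonal entries \<open>- B $$ (i, j) + O(\<epsilon>\<^sup>2)\<close>. In the expansion the diagonal of \<open>\<tau>\<close> is therefore
  \<open>kappa f + O(\<epsilon>\<^sup>2)\<close>. For odd \<open>f\<close> the terms of even order vanish, so an off-diagonal entry is
  \<open>- lam f * B $$ (i, j) + O(\<epsilon>\<^sup>2)\<close>. Altogether \<open>\<tau> = kappa f I - lam f B + G\<close> with all entries of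
  \<open>G\<close> of size \<open>O(\<epsilon>\<^sup>2)\<close> (\<open>tau_expansion\<close>).

  Entries of size \<open>O(\<epsilon>\<^sup>2)\<close> give an operator norm \<open>O(d * \<epsilon>\<^sup>2)\<close>, which is \<open>O(\<epsilon>)\<close> because \<open>d * \<epsilon>\<close> is
  bounded. Hence \<open>\<tau> = kappa f (I - A)\<close> with \<open>\<parallel>A\<parallel> = O(\<epsilon>)\<close>, where \<open>kappa f > 0\<close> by \<open>kappa_pos\<close>, and
  the inverse is \<open>(I + A + A\<^sup>2 (I - A)\<^sup>-\<^sup>1) / kappa f\<close>. The quadratic remainder has operator norm, and
  so entries, of size \<open>O(\<epsilon>\<^sup>2)\<close> (\<open>inverse_expansion\<close>).
\<close>

section \<open>Power series\<close>

lemma powser_coeffs_zero: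
  fixes c :: "nat \<Rightarrow> real"
  assumes "\<And>x. (\<lambda>n. c n * x ^ n) sums 0"
  shows "c n = 0"
proof (rule ccontr)
  assume n: "c n \<noteq> 0"
  have "c 0 = 0"
    using assms[of 0] by simp
  with n have "n > 0"
    by (cases n) auto
  obtain s where "0 < s" "\<And>z::real. z \<in> cball 0 s - {0} \<Longrightarrow> (0::real) \<noteq> 0"
    by (rule powser_0_nonzero[of 1 0 c "\<lambda>_. 0" n]) (use assms n \<open>n > 0\<close> in auto)
  from this(2)[of s] this(1) show False by auto
qed

lemma powser_coeffs_unique:
  fixes c d :: "nat \<Rightarrow> real"
  assumes "\<And>x. (\<lambda>n. c n * x ^ n) sums s x" "\<And>x. (\<lambda>n. d n * x ^ n) sums s x"
  shows "c n = d n"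
proof -
  have "(\<lambda>n. (c n - d n) * x ^ n) sums 0" for x
    using sums_diff[OF assms(1)[of x] assms(2)[of x]] by (simp add: left_diff_distrib)
  from powser_coeffs_zero[OF this, of n] show ?thesis by simp
qed

lemma summable_weighted:
  fixes h a :: "nat \<Rightarrow> real"
  assumes "summable (\<lambda>i. \<bar>h i\<bar>)" "\<And>l. \<bar>a l\<bar> \<le> M"
  shows "summable (\<lambda>i. \<bar>a i * h i\<bar>)"
proof (rule summable_comparison_test')
  show "summable (\<lambda>i. M * \<bar>h i\<bar>)"
    using assms(1) by (rule summable_mult)
  show "norm \<bar>a n * h n\<bar> \<le> M * \<bar>h n\<bar>" for n
    using assms(2)[of n] by (simp add: abs_mult mult_right_mono)
qed

text \<open>
  For \<open>a l = t ^ l\<close> with \<open>\<bar>t\<bar> \<le> 1\<close> this is the Cauchy product of \<open>\<Sum>h i * t ^ i\<close> and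
  \<open>\<Sum>g m * t ^ m\<close>; for other bounded sequences it evaluates the linear functional \<open>t ^ l \<mapsto> a l\<close> on that product. Both
  sides are iterated sums of the absolutely summable family \<open>a (m + i) * h i * g m\<close>, one along
  the rows and one along the antidiagonals.
\<close>
lemma twisted_Cauchy_product:
  fixes h g a :: "nat \<Rightarrow> real"
  assumes h: "summable (\<lambda>i. \<bar>h i\<bar>)" and g: "summable (\<lambda>m. \<bar>g m\<bar>)"
    and a: "\<And>l. \<bar>a l\<bar> \<le> M"
    and S: "(\<lambda>l. a l * (\<Sum>i\<le>l. h i * g (l - i))) sums S"
  shows "(\<lambda>m. g m * (\<Sum>i. a (m + i) * h i)) sums S"
proof -
  define P where "P = (\<lambda>(m, i). a (m + i) * h i * g m)"
  have hs: "(\<lambda>i. norm (h i)) summable_on UNIV" "(\<lambda>i. norm (g i)) summable_on UNIV"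
    using h g by (auto simp: summable_on_UNIV_nonneg_real_iff)
  have gh: "(\<lambda>p. norm (case p of (m, i) \<Rightarrow> g m * h i)) summable_on UNIV \<times> UNIV"
  proof (rule Infinite_Sum.abs_summable_on_Sigma_iff[THEN iffD2], intro conjI ballI)
    show "(\<lambda>y. norm (case (x, y) of (m, i) \<Rightarrow> g m * h i)) summable_on UNIV" for x
      using summable_on_cmult_right[OF hs(1), of "\<bar>g x\<bar>"] by (simp add: abs_mult)
    have "(\<Sum>\<^sub>\<infinity>i. \<bar>g m\<bar> * \<bar>h i\<bar>) = \<bar>g m\<bar> * (\<Sum>\<^sub>\<infinity>i. \<bar>h i\<bar>)" for m
      using hs(1) by (intro infsum_cmult_right) auto
    moreover have "(\<lambda>m. \<bar>g m\<bar> * \<bar>\<Sum>\<^sub>\<infinity>i. \<bar>h i\<bar>\<bar>) summable_on UNIV"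
      using summable_on_cmult_left[OF hs(2)] by simp
    ultimately show "(\<lambda>m. norm (\<Sum>\<^sub>\<infinity>i. norm (case (m, i) of (m, i) \<Rightarrow> g m * h i))) summable_on UNIV"
      by (simp add: abs_mult)
  qed
  have "(\<lambda>p. norm (P p)) summable_on UNIV \<times> UNIV"
  proof (rule Infinite_Sum.abs_summable_on_comparison_test)
    show "(\<lambda>p. norm (M * (case p of (m, i) \<Rightarrow> g m * h i))) summable_on UNIV \<times> UNIV"
      using summable_on_cmult_right[OF gh, of "\<bar>M\<bar>"] by (simp add: abs_mult)
    show "norm (P p) \<le> norm (M * (case p of (m, i) \<Rightarrow> g m * h i))" for p
    proof -
      have "\<bar>a (fst p + snd p)\<bar> \<le> \<bar>M\<bar>" using a[of "fst p + snd p"] by linarith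
      from mult_right_mono[OF this, of "\<bar>h (snd p)\<bar> * \<bar>g (fst p)\<bar>"]
      show ?thesis by (simp add: P_def abs_mult case_prod_beta mult_ac)
    qed
  qed
  then have "P summable_on UNIV \<times> UNIV"
    by (rule Infinite_Sum.abs_summable_summable)
  then obtain T where T: "(P has_sum T) (UNIV \<times> UNIV)"
    using summable_on_def by blast
  have row: "((\<lambda>i. P (m, i)) has_sum g m * (\<Sum>i. a (m + i) * h i)) UNIV" for m
  proof -
    have s: "summable (\<lambda>i. \<bar>a (m + i) * h i\<bar>)"
      by (rule summable_weighted[OF h, of "\<lambda>i. a (m + i)"]) (rule a)
    have "((\<lambda>i. a (m + i) * h i) has_sum (\<Sum>i. a (m + i) * h i)) UNIV"
      using s by (intro norm_summable_imp_has_sum)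
        (auto intro: summable_sums summable_rabs_cancel)
    from has_sum_cmult_right[OF this, of "g m"] show ?thesis
      by (simp add: P_def mult_ac)
  qed
  have "(\<lambda>m. g m * (\<Sum>i. a (m + i) * h i)) sums T"
    using has_sum_imp_sums[OF has_sum_Sigma'[OF T row]] by simp
  moreover
  have "((\<lambda>(l, i). a l * (h i * g (l - i))) has_sum T) (SIGMA l:UNIV. {..l})
        = (P has_sum T) (UNIV \<times> UNIV)"
    by (rule has_sum_reindex_bij_witness[where j = "\<lambda>(l, i). (l - i, i)" and i = "\<lambda>(m, i). (m + i, i)"])
       (auto simp: P_def)
  with T have D: "((\<lambda>(l, i). a l * (h i * g (l - i))) has_sum T) (SIGMA l:UNIV. {..l})"
    by simp
  have "(\<lambda>l. a l * (\<Sum>i\<le>l. h i * g (l - i))) sums T"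
    by (rule has_sum_imp_sums, rule has_sum_Sigma'[OF D])
       (auto simp: sum_distrib_left intro!: has_sum_finiteI)
  ultimately show ?thesis
    using S sums_unique2 by blast
qed

text \<open>
  The Taylor coefficients of \<open>t \<mapsto> exp (x * t\<^sup>2)\<close>. With this encoding, which pads the odd places with
  zeros, \<open>F f m x\<close> is the inner sum of the twisted Cauchy product.
\<close>
definition heat_coeff :: "real \<Rightarrow> nat \<Rightarrow> real" where
  "heat_coeff x i = (if even i then x ^ (i div 2) / fact (i div 2) else 0)"

lemma sums_heat_coeff_iff:
  "(\<lambda>i. a i * heat_coeff x i) sums s \<longleftrightarrow> (\<lambda>u. a (2 * u) * (x ^ u / fact u)) sums s"
proof -
  have "(\<lambda>u. a (2 * u) * heat_coeff x (2 * u)) sums s \<longleftrightarrow> (\<lambda>i. a i * heat_coeff x i) sums s"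
    by (rule sums_mono_reindex) (auto simp: strict_mono_def heat_coeff_def)
  then show ?thesis by (simp add: heat_coeff_def)
qed

lemma heat_coeff_sums_exp: "(\<lambda>i. heat_coeff x i * t ^ i) sums exp (x * t\<^sup>2)"
proof -
  have "(\<lambda>u. (x * t\<^sup>2) ^ u /\<^sub>R fact u) sums exp (x * t\<^sup>2)"
    by (rule exp_converges)
  then have "(\<lambda>u. t ^ (2 * u) * (x ^ u / fact u)) sums exp (x * t\<^sup>2)"
    by (simp add: power_mult_distrib divide_inverse mult_ac flip: power_mult)
  then show ?thesis
    by (subst mult.commute) (simp only: sums_heat_coeff_iff)
qed

lemma heat_coeff_abs_summable: "summable (\<lambda>i. \<bar>heat_coeff x i * t ^ i\<bar>)"
proof -
  have "\<bar>heat_coeff x i * t ^ i\<bar> = heat_coeff \<bar>x\<bar> i * \<bar>t\<bar> ^ i" for i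
    by (simp add: heat_coeff_def abs_mult power_abs)
  then show ?thesis
    using heat_coeff_sums_exp[of "\<bar>x\<bar>" "\<bar>t\<bar>"] by (simp add: sums_iff)
qed

lemma F_eq_heat_coeff: "F f m x = (\<Sum>i. deriv0 f (m + i) * heat_coeff x i)"
proof -
  have "(\<lambda>i. deriv0 f (m + i) * heat_coeff x i) sums s \<longleftrightarrow>
        (\<lambda>u. deriv0 f (2 * u + m) / fact u * x ^ u) sums s" for s
    using sums_heat_coeff_iff[of "\<lambda>i. deriv0 f (m + i)" x s]
    by (simp add: add.commute mult.commute)
  then show ?thesis
    by (simp add: F_def suminf_def)
qed

section \<open>Expectations determined by exponential moments\<close>

lemma expectation_power_series:
  fixes Y W :: "'a \<Rightarrow> real" and a :: "nat \<Rightarrow> real"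
  assumes [measurable]: "Y \<in> borel_measurable N" "W \<in> borel_measurable N"
    and int: "integrable N (\<lambda>x. exp (r * \<bar>Y x\<bar>) * \<bar>W x\<bar>)"
    and a: "\<And>k. \<bar>a k\<bar> \<le> M * r ^ k"
    and phi: "\<And>y. (\<lambda>k. a k / fact k * y ^ k) sums \<phi> y"
  shows "integrable N (\<lambda>x. \<phi> (Y x) * W x)"
    and "(\<lambda>k. a k * (\<integral>x. Y x ^ k / fact k * W x \<partial>N)) sums (\<integral>x. \<phi> (Y x) * W x \<partial>N)"
proof -
  define s where "s n x = (\<Sum>k<n. a k / fact k * Y x ^ k) * W x" for n x
  have M0: "0 \<le> M * r ^ k" for k
    using a[of k] by linarith
  have sm[measurable]: "s n \<in> borel_measurable N" for n
    unfolding s_def by measurable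
  have lim: "(\<lambda>n. s n x) \<longlonglongrightarrow> \<phi> (Y x) * W x" for x
    using phi[of "Y x"] unfolding s_def sums_def by (intro tendsto_mult tendsto_const)
  have pm[measurable]: "(\<lambda>x. \<phi> (Y x) * W x) \<in> borel_measurable N"
    by (rule borel_measurable_LIMSEQ_real[OF lim sm])
  have bound: "norm (s n x) \<le> M * (exp (r * \<bar>Y x\<bar>) * \<bar>W x\<bar>)" for n x
  proof -
    have e: "(\<lambda>k. M * ((r * \<bar>Y x\<bar>) ^ k /\<^sub>R fact k)) sums (M * exp (r * \<bar>Y x\<bar>))"
      by (intro sums_mult exp_converges)
    have "\<bar>\<Sum>k<n. a k / fact k * Y x ^ k\<bar> \<le> (\<Sum>k<n. \<bar>a k / fact k * Y x ^ k\<bar>)"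
      by (rule sum_abs)
    also have "\<dots> \<le> (\<Sum>k<n. M * ((r * \<bar>Y x\<bar>) ^ k /\<^sub>R fact k))"
    proof (rule sum_mono)
      fix k
      have "\<bar>a k\<bar> * (\<bar>Y x\<bar> ^ k / fact k) \<le> M * r ^ k * (\<bar>Y x\<bar> ^ k / fact k)"
        by (intro mult_right_mono a) auto
      then show "\<bar>a k / fact k * Y x ^ k\<bar> \<le> M * ((r * \<bar>Y x\<bar>) ^ k /\<^sub>R fact k)"
        by (simp add: abs_mult power_abs power_mult_distrib divide_inverse mult_ac)
    qed
    also have "\<dots> \<le> M * exp (r * \<bar>Y x\<bar>)"
    proof -
      have "0 \<le> M * ((r * \<bar>Y x\<bar>) ^ k /\<^sub>R fact k)" for k
        using mult_nonneg_nonneg[OF M0[of k], of "\<bar>Y x\<bar> ^ k / fact k"]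
        by (simp add: power_mult_distrib divide_inverse mult_ac)
      then show ?thesis
        using sum_le_suminf[of "\<lambda>k. M * ((r * \<bar>Y x\<bar>) ^ k /\<^sub>R fact k)" "{..<n}"] e
        by (auto simp: sums_iff)
    qed
    finally show ?thesis
      by (simp add: s_def abs_mult mult_right_mono flip: mult.assoc)
  qed
  have w: "integrable N (\<lambda>x. M * (exp (r * \<bar>Y x\<bar>) * \<bar>W x\<bar>))"
    using int by simp
  note dom = pm sm w AE_I2[OF lim] AE_I2[OF bound]
  show "integrable N (\<lambda>x. \<phi> (Y x) * W x)"
    by (rule integrable_dominated_convergence[OF dom])
  have term_int: "integrable N (\<lambda>x. a k * (Y x ^ k / fact k * W x))" for k
  proof -
    have "integrable N (\<lambda>x. s (Suc k) x - s k x)"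
      using integrable_dominated_convergence2[OF dom] by (intro Bochner_Integration.integrable_diff)
    then show ?thesis
      by (simp add: s_def algebra_simps)
  qed
  have "integral\<^sup>L N (s n) = (\<Sum>k<n. a k * (\<integral>x. Y x ^ k / fact k * W x \<partial>N))" for n
  proof -
    have "s n = (\<lambda>x. \<Sum>k<n. a k * (Y x ^ k / fact k * W x))"
      by (simp add: s_def sum_distrib_left mult_ac fun_eq_iff)
    then have "integral\<^sup>L N (s n) = (\<Sum>k<n. \<integral>x. a k * (Y x ^ k / fact k * W x) \<partial>N)"
      using term_int by (simp only: Bochner_Integration.integral_sum)
    then show ?thesis by simp
  qed
  then show "(\<lambda>k. a k * (\<integral>x. Y x ^ k / fact k * W x \<partial>N)) sums (\<integral>x. \<phi> (Y x) * W x \<partial>N)"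
    using integral_dominated_convergence[OF dom] by (simp add: sums_def)
qed

text \<open>
  The exponential transform of \<open>W\<close> along \<open>Y\<close> determines all \<open>\<integral>Y ^ k * W\<close> as power series
  coefficients, and \<open>\<integral>f Y * W\<close> is obtained from the transform by the substitution
  \<open>t ^ k \<mapsto> deriv0 f k\<close>. When the transform has a factor \<open>exp (b / 2 * t\<^sup>2)\<close>, the substitution turns
  \<open>t ^ m\<close> times this factor into \<open>F f m (b / 2)\<close>.
\<close>
lemma expectation_of_Gaussian_transform:
  fixes Y W :: "'a \<Rightarrow> real" and f :: "real \<Rightarrow> real"
  assumes meas[measurable]: "Y \<in> borel_measurable N" "W \<in> borel_measurable N"
    and int: "\<And>r. integrable N (\<lambda>x. exp (r * Y x) * W x)"
    and g: "\<And>t. summable (\<lambda>m. \<bar>g m * t ^ m\<bar>)"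
    and mgf: "\<And>t. (\<integral>x. exp (t * Y x) * W x \<partial>N) = exp (b / 2 * t\<^sup>2) * (\<Sum>m. g m * t ^ m)"
    and taylor: "\<And>x. (\<lambda>k. deriv0 f k / fact k * x ^ k) sums f x"
    and bound: "\<And>k. \<bar>deriv0 f k\<bar> \<le> M"
  shows "integrable N (\<lambda>x. f (Y x) * W x)"
    and "(\<lambda>m. g m * F f m (b / 2)) sums (\<integral>x. f (Y x) * W x \<partial>N)"
proof -
  have int': "integrable N (\<lambda>x. exp (r * \<bar>Y x\<bar>) * \<bar>W x\<bar>)" for r
  proof (rule Bochner_Integration.integrable_bound)
    show "integrable N (\<lambda>x. \<bar>exp (r * Y x) * W x\<bar> + \<bar>exp (- r * Y x) * W x\<bar>)"
      by (intro Bochner_Integration.integrable_add integrable_abs int)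
    show "AE x in N. norm (exp (r * \<bar>Y x\<bar>) * \<bar>W x\<bar>)
        \<le> norm (\<bar>exp (r * Y x) * W x\<bar> + \<bar>exp (- r * Y x) * W x\<bar>)"
    proof (rule AE_I2)
      fix x
      have "exp (r * \<bar>Y x\<bar>) * \<bar>W x\<bar> \<le> (exp (r * Y x) + exp (- r * Y x)) * \<bar>W x\<bar>"
        by (intro mult_right_mono) (auto simp: abs_if)
      then show "norm (exp (r * \<bar>Y x\<bar>) * \<bar>W x\<bar>)
          \<le> norm (\<bar>exp (r * Y x) * W x\<bar> + \<bar>exp (- r * Y x) * W x\<bar>)"
        by (simp add: abs_mult distrib_right)
    qed
  qed simp
  define c where "c k = (\<integral>x. Y x ^ k / fact k * W x \<partial>N)" for k
  let ?h = "heat_coeff (b / 2)"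
  have c_sums: "(\<lambda>k. c k * t ^ k) sums (exp (b / 2 * t\<^sup>2) * (\<Sum>m. g m * t ^ m))" for t
  proof -
    have "(\<lambda>k. t ^ k * c k) sums (\<integral>x. exp (t * Y x) * W x \<partial>N)"
      unfolding c_def
    proof (rule expectation_power_series(2)[OF meas int'[of "\<bar>t\<bar>"], where M = 1])
      show "\<bar>t ^ k\<bar> \<le> 1 * \<bar>t\<bar> ^ k" for k
        by (simp add: power_abs)
      show "(\<lambda>k. t ^ k / fact k * y ^ k) sums exp (t * y)" for y
        using exp_converges[of "t * y"] by (simp add: power_mult_distrib divide_inverse mult_ac)
    qed
    then show ?thesis
      unfolding mgf by (simp add: mult.commute)
  qed
  have "(\<lambda>k. (\<Sum>i\<le>k. ?h i * g (k - i)) * t ^ k) sums (exp (b / 2 * t\<^sup>2) * (\<Sum>m. g m * t ^ m))" for t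
  proof -
    have "(\<lambda>k. \<Sum>i\<le>k. (?h i * t ^ i) * (g (k - i) * t ^ (k - i)))
        sums ((\<Sum>i. ?h i * t ^ i) * (\<Sum>m. g m * t ^ m))"
      using heat_coeff_abs_summable g by (intro Cauchy_product_sums) simp_all
    moreover have "(\<Sum>i\<le>k. (?h i * t ^ i) * (g (k - i) * t ^ (k - i)))
        = (\<Sum>i\<le>k. ?h i * g (k - i)) * t ^ k" for k
      unfolding sum_distrib_right
    proof (rule sum.cong[OF refl])
      fix i assume "i \<in> {..k}"
      then have "t ^ k = t ^ i * t ^ (k - i)"
        by (simp flip: power_add)
      then show "(?h i * t ^ i) * (g (k - i) * t ^ (k - i)) = ?h i * g (k - i) * t ^ k"
        by simp
    qed
    ultimately show ?thesis
      using heat_coeff_sums_exp[of "b / 2" t] by (simp add: sums_iff)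
  qed
  from powser_coeffs_unique[OF c_sums this]
  have c_eq: "c k = (\<Sum>i\<le>k. ?h i * g (k - i))" for k .
  have bound': "\<bar>deriv0 f k\<bar> \<le> M * 1 ^ k" for k
    using bound by simp
  note f_series = expectation_power_series[OF meas int'[of 1] bound' taylor]
  show "integrable N (\<lambda>x. f (Y x) * W x)"
    by (rule f_series(1))
  have "(\<lambda>l. deriv0 f l * (\<Sum>i\<le>l. ?h i * g (l - i))) sums (\<integral>x. f (Y x) * W x \<partial>N)"
    using f_series(2) unfolding c_def[symmetric] c_eq .
  then have "(\<lambda>m. g m * (\<Sum>i. deriv0 f (m + i) * ?h i)) sums (\<integral>x. f (Y x) * W x \<partial>N)"
    using heat_coeff_abs_summable[of "b / 2" 1] g[of 1] bound
    by (intro twisted_Cauchy_product[of ?h g "deriv0 f" M]) simp_all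
  then show "(\<lambda>m. g m * F f m (b / 2)) sums (\<integral>x. f (Y x) * W x \<partial>N)"
    by (simp only: F_eq_heat_coeff)
qed

section \<open>The two-point function of a Gaussian pair\<close>

lemma
  assumes bound: "\<And>k. \<bar>deriv0 f k\<bar> \<le> M"
  shows F_summable: "summable (\<lambda>u. deriv0 f (2 * u + k) / fact u * x ^ u)"
    and F_exp_bound: "\<bar>F f k x\<bar> \<le> M * exp \<bar>x\<bar>"
proof -
  have e: "(\<lambda>u. M * (\<bar>x\<bar> ^ u / fact u)) sums (M * exp \<bar>x\<bar>)"
    using sums_mult[OF exp_converges[of "\<bar>x\<bar>"], of M] by (simp add: divide_inverse mult.commute)
  have b: "norm (deriv0 f (2 * u + k) / fact u * x ^ u) \<le> M * (\<bar>x\<bar> ^ u / fact u)" for u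
    using mult_right_mono[OF bound[of "2 * u + k"], of "\<bar>x\<bar> ^ u / fact u"]
    by (simp add: abs_mult power_abs)
  have "summable (\<lambda>u. norm (deriv0 f (2 * u + k) / fact u * x ^ u))"
    by (rule summable_comparison_test'[OF sums_summable[OF e]]) (use b in auto)
  then show "summable (\<lambda>u. deriv0 f (2 * u + k) / fact u * x ^ u)"
    by (rule summable_norm_cancel)
  show "\<bar>F f k x\<bar> \<le> M * exp \<bar>x\<bar>"
    unfolding F_def using norm_suminf_le[OF b sums_summable[OF e]] e
    by (simp add: sums_iff)
qed

lemma F_bound:
  assumes bound: "\<And>k. \<bar>deriv0 f k\<bar> \<le> M" and "\<bar>x\<bar> \<le> 1"
  shows "\<bar>F f k x\<bar> \<le> M * exp 1"
proof -
  have "M \<ge> 0" using bound[of 0] by linarith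
  then have "M * exp \<bar>x\<bar> \<le> M * exp 1"
    using assms(2) by (intro mult_left_mono) auto
  then show ?thesis using F_exp_bound[OF bound, of k x] by linarith
qed

lemma F_Lipschitz:
  assumes bound: "\<And>k. \<bar>deriv0 f k\<bar> \<le> M" and x: "\<bar>x\<bar> \<le> 1" and y: "\<bar>y\<bar> \<le> 1"
  shows "\<bar>F f k x - F f k y\<bar> \<le> M * exp 1 * \<bar>x - y\<bar>"
proof -
  let ?d = "\<lambda>u. deriv0 f (2 * u + k) / fact u * x ^ u - deriv0 f (2 * u + k) / fact u * y ^ u"
  have M0: "M \<ge> 0" using bound[of 0] by linarith
  have fs: "real (Suc u) / fact (Suc u) = (1 / fact u :: real)" for u
    by (simp add: fact_Suc del: of_nat_Suc)
  have "(\<lambda>u. real (Suc u) / fact (Suc u)) sums exp 1"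
    unfolding fs using exp_converges[of "1::real"] by (simp add: divide_inverse)
  then have "(\<lambda>u. real u / fact u) sums exp 1"
    by (subst (asm) sums_Suc_iff) simp
  from sums_mult2[OF sums_mult[OF this, of M], of "\<bar>x - y\<bar>"]
  have e: "(\<lambda>u. M * (real u / fact u) * \<bar>x - y\<bar>) sums (M * exp 1 * \<bar>x - y\<bar>)" .
  have b: "norm (?d u) \<le> M * (real u / fact u) * \<bar>x - y\<bar>" for u
  proof -
    have "norm (?d u) = \<bar>deriv0 f (2 * u + k)\<bar> * (\<bar>x ^ u - y ^ u\<bar> / fact u)"
    proof -
      have "?d u = deriv0 f (2 * u + k) * ((x ^ u - y ^ u) / fact u)"
        by (simp add: algebra_simps diff_divide_distrib)
      then show ?thesis by (simp only: real_norm_def abs_mult abs_divide) simp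
    qed
    also have "\<dots> \<le> M * (real u * \<bar>x - y\<bar> / fact u)"
      using norm_power_diff[of x y u] x y M0 bound
      by (intro mult_mono divide_right_mono) auto
    finally show ?thesis by simp
  qed
  have "F f k x - F f k y = suminf ?d"
    unfolding F_def by (intro suminf_diff F_summable[OF bound])
  then show ?thesis
    using norm_suminf_le[OF b sums_summable[OF e]] e by (simp add: sums_iff)
qed

text \<open>
  The value of \<open>E[f(X) f(Y)]\<close> for a centred Gaussian pair with variances \<open>a\<close>, \<open>b\<close> and covariance
  \<open>c\<close>; at \<open>a = b = c\<close> it is the second moment of \<open>f(X)\<close>.
\<close>
definition pair_expectation :: "(real \<Rightarrow> real) \<Rightarrow> real \<Rightarrow> real \<Rightarrow> real \<Rightarrow> real" where
  "pair_expectation f a c b = (\<Sum>m. c ^ m / fact m * F f m (a / 2) * F f m (b / 2))"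

lemma exp_series: "(\<lambda>m. x ^ m / fact m) sums exp (x::real)"
  using exp_converges[of x] by (simp add: divide_inverse mult.commute)

text \<open>
  The moment generating function is \<open>exp (a / 2 * s\<^sup>2) * exp (b / 2 * t\<^sup>2) * (\<Sum>m. (c * s * t) ^ m / fact m)\<close>.
  Replacing the powers of \<open>s\<close> and then those of \<open>t\<close> by derivatives of \<open>f\<close> produces the two
  factors \<open>F f m\<close>. Degenerate pairs are included, in particular \<open>X = Y\<close>.
\<close>
lemma expectation_pair:
  fixes X Y :: "'a \<Rightarrow> real" and f :: "real \<Rightarrow> real"
  assumes meas[measurable]: "X \<in> borel_measurable N" "Y \<in> borel_measurable N"
    and int: "\<And>s t. integrable N (\<lambda>x. exp (s * X x + t * Y x))"
    and mgf: "\<And>s t. (\<integral>x. exp (s * X x + t * Y x) \<partial>N)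
                = exp (a / 2 * s\<^sup>2 + c * s * t + b / 2 * t\<^sup>2)"
    and taylor: "\<And>x. (\<lambda>k. deriv0 f k / fact k * x ^ k) sums f x"
    and bound: "\<And>k. \<bar>deriv0 f k\<bar> \<le> M"
  shows "integrable N (\<lambda>x. f (X x) * f (Y x))"
    and "(\<integral>x. f (X x) * f (Y x) \<partial>N) = pair_expectation f a c b"
proof -
  have f_meas[measurable]: "f \<in> borel_measurable borel"
    by (rule borel_measurable_LIMSEQ_real[where u = "\<lambda>n x. \<Sum>k<n. deriv0 f k / fact k * x ^ k"])
       (use taylor in \<open>auto simp: sums_def\<close>)
  have int': "integrable N (\<lambda>x. exp (s * X x) * exp (t * Y x))" for s t
    using int[of s t] by (simp add: exp_add)
  have step1: "integrable N (\<lambda>x. f (X x) * exp (t * Y x)) \<and>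
    (\<lambda>m. exp (b / 2 * t\<^sup>2) * ((c * t) ^ m / fact m) * F f m (a / 2))
      sums (\<integral>x. f (X x) * exp (t * Y x) \<partial>N)" for t
  proof -
    have g: "(\<lambda>m. exp (b / 2 * t\<^sup>2) * ((c * t) ^ m / fact m) * s ^ m)
        sums (exp (b / 2 * t\<^sup>2) * exp (c * t * s))" for s
      using sums_mult[OF exp_series[of "c * t * s"], of "exp (b / 2 * t\<^sup>2)"]
      by (simp add: power_mult_distrib mult_ac)
    have sm: "summable (\<lambda>m. \<bar>exp (b / 2 * t\<^sup>2) * ((c * t) ^ m / fact m) * s ^ m\<bar>)" for s
      using summable_mult[OF sums_summable[OF exp_series[of "\<bar>c * t * s\<bar>"]], of "exp (b / 2 * t\<^sup>2)"]
      by (simp add: power_mult_distrib mult_ac abs_mult power_abs)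
    have mg: "(\<integral>x. exp (s * X x) * exp (t * Y x) \<partial>N) = exp (a / 2 * s\<^sup>2) *
        (\<Sum>m. exp (b / 2 * t\<^sup>2) * ((c * t) ^ m / fact m) * s ^ m)" for s
      using mgf[of s t] sums_unique[OF g[of s]] by (simp add: exp_add mult_ac)
    note gs = expectation_of_Gaussian_transform[OF meas(1) _ int' sm mg taylor bound]
    show ?thesis
      by (intro conjI gs) measurable
  qed
  have int2: "integrable N (\<lambda>x. exp (t * Y x) * f (X x))" for t
    using step1[of t] by (simp add: mult.commute)
  let ?g = "\<lambda>m. c ^ m / fact m * F f m (a / 2)"
  have g: "summable (\<lambda>m. \<bar>?g m * t ^ m\<bar>)" for t
  proof (rule summable_comparison_test')
    show "summable (\<lambda>m. M * exp \<bar>a / 2\<bar> * (\<bar>c * t\<bar> ^ m / fact m))"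
      by (intro summable_mult sums_summable[OF exp_series])
    show "norm \<bar>?g m * t ^ m\<bar> \<le> M * exp \<bar>a / 2\<bar> * (\<bar>c * t\<bar> ^ m / fact m)" for m
      using mult_right_mono[OF F_exp_bound[OF bound, of m "a / 2"], of "\<bar>c * t\<bar> ^ m / fact m"]
      by (simp add: abs_mult power_abs power_mult_distrib mult_ac)
  qed
  have mgf2: "(\<integral>x. exp (t * Y x) * f (X x) \<partial>N) = exp (b / 2 * t\<^sup>2) * (\<Sum>m. ?g m * t ^ m)" for t
  proof -
    have "(\<lambda>m. ?g m * t ^ m) sums (\<Sum>m. ?g m * t ^ m)"
      using g[of t] by (intro summable_sums) (rule summable_rabs_cancel)
    from sums_mult[OF this, of "exp (b / 2 * t\<^sup>2)"]
    have "(\<lambda>m. exp (b / 2 * t\<^sup>2) * ((c * t) ^ m / fact m) * F f m (a / 2))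
        sums (exp (b / 2 * t\<^sup>2) * (\<Sum>m. ?g m * t ^ m))"
      by (simp add: power_mult_distrib mult_ac)
    from sums_unique2[OF step1[of t, THEN conjunct2] this] show ?thesis
      by (simp only: mult.commute[of "exp (t * Y _)"])
  qed
  have fX: "(\<lambda>x. f (X x)) \<in> borel_measurable N" by measurable
  note step2 = expectation_of_Gaussian_transform[OF meas(2) fX int2 g mgf2 taylor bound]
  show "integrable N (\<lambda>x. f (X x) * f (Y x))"
    using step2(1) by (simp add: mult.commute)
  show "(\<integral>x. f (X x) * f (Y x) \<partial>N) = pair_expectation f a c b"
    using step2(2) by (simp add: pair_expectation_def sums_iff mult.commute[of "f (X _)"])
qed

lemma pair_expectation_sums:
  assumes bound: "\<And>k. \<bar>deriv0 f k\<bar> \<le> M"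
  shows "(\<lambda>m. c ^ m / fact m * F f m (a / 2) * F f m (b / 2)) sums pair_expectation f a c b"
proof -
  have "summable (\<lambda>m. \<bar>c ^ m / fact m * F f m (a / 2) * F f m (b / 2)\<bar>)"
  proof (rule summable_comparison_test')
    show "summable (\<lambda>m. M * exp \<bar>a / 2\<bar> * (M * exp \<bar>b / 2\<bar>) * (\<bar>c\<bar> ^ m / fact m))"
      by (intro summable_mult sums_summable[OF exp_series])
    fix m
    have "\<bar>F f m (a / 2)\<bar> * \<bar>F f m (b / 2)\<bar> \<le> M * exp \<bar>a / 2\<bar> * (M * exp \<bar>b / 2\<bar>)"
      by (rule mult_mono[OF F_exp_bound[OF bound] F_exp_bound[OF bound]])
         (rule order_trans[OF abs_ge_zero F_exp_bound[OF bound]], simp)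
    from mult_right_mono[OF this, of "\<bar>c\<bar> ^ m / fact m"]
    show "norm \<bar>c ^ m / fact m * F f m (a / 2) * F f m (b / 2)\<bar>
        \<le> M * exp \<bar>a / 2\<bar> * (M * exp \<bar>b / 2\<bar>) * (\<bar>c\<bar> ^ m / fact m)"
      by (simp add: abs_mult power_abs mult_ac)
  qed
  then show ?thesis
    unfolding pair_expectation_def by (intro summable_sums) (rule summable_rabs_cancel)
qed

section \<open>Estimates near independent standard variables\<close>

lemma odd_imp_even_deriv0_zero:
  fixes f :: "real \<Rightarrow> real"
  assumes odd: "\<And>x. f (- x) = - f x"
    and taylor: "\<And>x. (\<lambda>k. deriv0 f k / fact k * x ^ k) sums f x"
    and k: "even k"
  shows "deriv0 f k = 0"
proof -
  have "(\<lambda>k. ((-1) ^ k * (deriv0 f k / fact k)) * x ^ k) sums (- f x)" for x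
  proof -
    have "(-1) ^ k * (deriv0 f k / fact k) * x ^ k = deriv0 f k / fact k * (- x) ^ k" for k
      by (simp add: power_minus[of x])
    then show ?thesis
      using taylor[of "- x"] by (simp only: odd)
  qed
  moreover have "(\<lambda>k. (- (deriv0 f k / fact k)) * x ^ k) sums (- f x)" for x
    using sums_minus[OF taylor[of x]] by simp
  ultimately have "(-1) ^ k * (deriv0 f k / fact k) = - (deriv0 f k / fact k)"
    by (rule powser_coeffs_unique)
  with k show ?thesis by simp
qed

lemma odd_imp_even_F_zero:
  fixes f :: "real \<Rightarrow> real"
  assumes "\<And>x. f (- x) = - f x" "\<And>x. (\<lambda>k. deriv0 f k / fact k * x ^ k) sums f x" "even k"
  shows "F f k x = 0"
  using odd_imp_even_deriv0_zero[OF assms(1,2)] assms(3) by (simp add: F_def)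

lemma kappa_eq_pair_expectation:
  fixes f :: "real \<Rightarrow> real"
  assumes odd: "\<And>x. f (- x) = - f x"
    and taylor: "\<And>x. (\<lambda>k. deriv0 f k / fact k * x ^ k) sums f x"
    and bound: "\<And>k. \<bar>deriv0 f k\<bar> \<le> M"
  shows "kappa f = pair_expectation f 1 1 1"
proof -
  let ?t = "\<lambda>k. 1 ^ k / fact k * F f k (1 / 2) * F f k (1 / 2)"
  have "(\<lambda>m. ?t (2 * m + 1)) sums pair_expectation f 1 1 1 \<longleftrightarrow> ?t sums pair_expectation f 1 1 1"
  proof (rule sums_mono_reindex)
    show "?t n = 0" if "n \<notin> range (\<lambda>m. 2 * m + 1)" for n
    proof -
      from that have "even n" by (metis oddE rangeI)
      then show ?thesis using odd_imp_even_F_zero[OF odd taylor] by simp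
    qed
  qed (auto simp: strict_mono_def)
  with pair_expectation_sums[OF bound, of 1 1 1] show ?thesis
    by (simp add: kappa_def sums_iff power2_eq_square)
qed

text \<open>
  The constant comes from \<open>\<bar>v ^ m - 1\<bar> \<le> 4 ^ m * \<bar>v - 1\<bar>\<close> on \<open>[0, 2]\<close> and the Lipschitz bound for
  \<open>F f m\<close>, summed against \<open>1 / fact m\<close>.
\<close>
lemma pair_expectation_diagonal:
  assumes bound: "\<And>k. \<bar>deriv0 f k\<bar> \<le> M" and v: "\<bar>v - 1\<bar> \<le> 1"
  shows "\<bar>pair_expectation f v v v - pair_expectation f 1 1 1\<bar>
      \<le> (M * exp 1)\<^sup>2 * (exp 4 + exp 1) * \<bar>v - 1\<bar>"
proof -
  define L where "L = M * exp 1"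
  have L: "\<bar>F f m (v / 2)\<bar> \<le> L" "\<bar>F f m (1 / 2)\<bar> \<le> L" for m
    unfolding L_def using v by (auto intro!: F_bound[OF bound])
  have L0: "0 \<le> L" using order_trans[OF abs_ge_zero L(1)] .
  have Lip: "\<bar>F f m (v / 2) - F f m (1 / 2)\<bar> \<le> L * (\<bar>v - 1\<bar> / 2)" for m
  proof -
    have h: "\<bar>v / 2 - 1 / 2\<bar> = \<bar>v - 1\<bar> / 2"
      by (simp flip: diff_divide_distrib)
    have h': "\<bar>v / 2\<bar> \<le> 1" "\<bar>1 / 2 :: real\<bar> \<le> 1"
      using v by auto
    show ?thesis
      unfolding L_def h[symmetric] by (rule F_Lipschitz[OF bound h'])
  qed
  let ?d = "\<lambda>m. v ^ m / fact m * F f m (v / 2) * F f m (v / 2)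
              - 1 ^ m / fact m * F f m (1 / 2) * F f m (1 / 2)"
  have ds: "?d sums (pair_expectation f v v v - pair_expectation f 1 1 1)"
    by (intro sums_diff pair_expectation_sums[OF bound])
  have pw: "\<bar>v ^ m - 1\<bar> \<le> 4 ^ m * \<bar>v - 1\<bar>" for m
  proof -
    \<comment> \<open>Halving \<open>v\<close> and 1 brings both into the unit disc, where powers have the Lipschitz constant \<open>m\<close>.\<close>
    have "\<bar>(v / 2) ^ m - (1 / 2) ^ m\<bar> \<le> real m * (\<bar>v - 1\<bar> / 2)"
      using norm_power_diff[of "v / 2" "1 / 2" m] v by (simp flip: diff_divide_distrib)
    then have "2 ^ m * \<bar>(v / 2) ^ m - (1 / 2) ^ m\<bar> \<le> 2 ^ m * (real m * (\<bar>v - 1\<bar> / 2))"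
      by (rule mult_left_mono) simp
    also have "2 ^ m * \<bar>(v / 2) ^ m - (1 / 2) ^ m\<bar> = \<bar>2 ^ m * ((v / 2) ^ m - (1 / 2) ^ m)\<bar>"
      by (simp add: abs_mult)
    also have "2 ^ m * ((v / 2) ^ m - (1 / 2) ^ m) = v ^ m - 1"
      by (simp add: right_diff_distrib power_divide)
    also have "2 ^ m * (real m * (\<bar>v - 1\<bar> / 2)) \<le> 2 ^ m * (2 ^ m * \<bar>v - 1\<bar>)"
    proof (intro mult_left_mono mult_mono)
      show "real m \<le> 2 ^ m" using of_nat_less_two_power[of m] by (simp add: less_imp_le)
    qed auto
    finally show ?thesis
      by (simp flip: mult.assoc power_mult_distrib)
  qed
  have b: "norm (?d m) \<le> L\<^sup>2 * \<bar>v - 1\<bar> * (4 ^ m / fact m + 1 ^ m / fact m)" for m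
  proof -
    define p q where "p = F f m (v / 2)" and "q = F f m (1 / 2)"
    have "\<bar>v ^ m * p * p - q * q\<bar> = \<bar>(v ^ m - 1) * (p * p) + (p - q) * (p + q)\<bar>"
      by (simp add: algebra_simps)
    also have "\<dots> \<le> \<bar>(v ^ m - 1) * (p * p)\<bar> + \<bar>(p - q) * (p + q)\<bar>"
      by (rule abs_triangle_ineq)
    also have "\<bar>(v ^ m - 1) * (p * p)\<bar> \<le> 4 ^ m * \<bar>v - 1\<bar> * (L * L)"
      unfolding abs_mult using pw L L0 by (intro mult_mono) (auto simp: p_def)
    also have "\<bar>(p - q) * (p + q)\<bar> \<le> L * (\<bar>v - 1\<bar> / 2) * (2 * L)"
      unfolding abs_mult using Lip L[of m] L0
      by (intro mult_mono) (auto simp: p_def q_def)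
    finally have *: "\<bar>v ^ m * p * p - q * q\<bar> \<le> L\<^sup>2 * \<bar>v - 1\<bar> * (4 ^ m + 1)"
      by (simp add: algebra_simps power2_eq_square)
    have "?d m = (v ^ m * p * p - q * q) / fact m"
      by (simp add: p_def q_def diff_divide_distrib)
    then have "norm (?d m) = \<bar>v ^ m * p * p - q * q\<bar> / fact m" by simp
    also have "\<dots> \<le> L\<^sup>2 * \<bar>v - 1\<bar> * (4 ^ m + 1) / fact m"
      using * by (rule divide_right_mono) simp
    also have "\<dots> = L\<^sup>2 * \<bar>v - 1\<bar> * (4 ^ m / fact m + 1 ^ m / fact m)"
      by (simp only: add_divide_distrib power_one times_divide_eq_right[symmetric])
    finally show ?thesis .
  qed
  have e: "(\<lambda>m. L\<^sup>2 * \<bar>v - 1\<bar> * (4 ^ m / fact m + 1 ^ m / fact m))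
      sums (L\<^sup>2 * \<bar>v - 1\<bar> * (exp 4 + exp 1))"
    by (intro sums_mult sums_add exp_series)
  show ?thesis
    using norm_suminf_le[OF b sums_summable[OF e]] e ds
    by (simp add: sums_iff L_def mult_ac)
qed

text \<open>
  For odd \<open>f\<close> the series in \<open>c\<close> has no constant term, so its value is the linear term up to
  \<open>O(c\<^sup>2)\<close>; the linear coefficient is \<open>lam f\<close> up to the deviations of the variances from 1.
\<close>
lemma pair_expectation_off_diagonal:
  fixes f :: "real \<Rightarrow> real"
  assumes odd: "\<And>x. f (- x) = - f x"
    and taylor: "\<And>x. (\<lambda>k. deriv0 f k / fact k * x ^ k) sums f x"
    and bound: "\<And>k. \<bar>deriv0 f k\<bar> \<le> M"
    and a: "\<bar>a - 1\<bar> \<le> 1" and b: "\<bar>b - 1\<bar> \<le> 1" and c: "\<bar>c\<bar> \<le> 1"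
  shows "\<bar>pair_expectation f a c b - lam f * c\<bar>
      \<le> (M * exp 1)\<^sup>2 * (\<bar>c\<bar> * (\<bar>a - 1\<bar> + \<bar>b - 1\<bar>) + c\<^sup>2 * exp 1)"
proof -
  define L where "L = M * exp 1"
  have L: "\<bar>F f m (a / 2)\<bar> \<le> L" "\<bar>F f m (b / 2)\<bar> \<le> L" "\<bar>F f m (1 / 2)\<bar> \<le> L" for m
    unfolding L_def using a b by (auto intro!: F_bound[OF bound])
  have L0: "0 \<le> L" using order_trans[OF abs_ge_zero L(1)] .
  have Lip: "\<bar>F f m (v / 2) - F f m (1 / 2)\<bar> \<le> L * \<bar>v - 1\<bar>" if "\<bar>v - 1\<bar> \<le> 1" for m v
  proof -
    have h: "\<bar>v / 2 - 1 / 2\<bar> = \<bar>v - 1\<bar> / 2"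
      by (simp flip: diff_divide_distrib)
    have h': "\<bar>v / 2\<bar> \<le> 1" "\<bar>1 / 2 :: real\<bar> \<le> 1"
      using that by auto
    have "\<bar>F f m (v / 2) - F f m (1 / 2)\<bar> \<le> L * (\<bar>v - 1\<bar> / 2)"
      unfolding L_def h[symmetric] by (rule F_Lipschitz[OF bound h'])
    also have "\<dots> \<le> L * \<bar>v - 1\<bar>" using L0 by (intro mult_left_mono) auto
    finally show ?thesis .
  qed
  let ?t = "\<lambda>m. c ^ m / fact m * F f m (a / 2) * F f m (b / 2)"
  have "?t 0 = 0" using odd_imp_even_F_zero[OF odd taylor, of 0] by simp
  have "(\<lambda>m. ?t (m + 2)) sums (pair_expectation f a c b - (\<Sum>m<2. ?t m))"
    using pair_expectation_sums[OF bound, of c a b] by (rule sums_split_initial_segment)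
  moreover have "(\<Sum>m<2. ?t m) = c * F f 1 (a / 2) * F f 1 (b / 2)"
    using \<open>?t 0 = 0\<close> by (simp add: numeral_2_eq_2)
  ultimately have ts: "(\<lambda>m. ?t (m + 2)) sums
      (pair_expectation f a c b - c * F f 1 (a / 2) * F f 1 (b / 2))" by simp
  have tb: "norm (?t (m + 2)) \<le> c\<^sup>2 * L\<^sup>2 * (1 ^ m / fact m)" for m
  proof -
    have "\<bar>c ^ (m + 2)\<bar> = \<bar>c\<bar> ^ m * c\<^sup>2"
      by (simp only: power_abs[symmetric] power_add abs_mult abs_power2)
    then have "\<bar>c ^ (m + 2)\<bar> \<le> c\<^sup>2"
      using c by (simp add: mult_left_le_one_le power_le_one)
    moreover have "\<bar>F f (m + 2) (a / 2)\<bar> * \<bar>F f (m + 2) (b / 2)\<bar> \<le> L * L"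
      using L L0 by (intro mult_mono) auto
    ultimately have "\<bar>c ^ (m + 2)\<bar> * (\<bar>F f (m + 2) (a / 2)\<bar> * \<bar>F f (m + 2) (b / 2)\<bar>) / fact (m + 2)
        \<le> c\<^sup>2 * (L * L) / fact m"
      by (intro frac_le mult_mono[of _ "c\<^sup>2"] fact_mono) auto
    then show ?thesis by (simp add: abs_mult power2_eq_square mult_ac)
  qed
  have e: "(\<lambda>m. c\<^sup>2 * L\<^sup>2 * (1 ^ m / fact m)) sums (c\<^sup>2 * L\<^sup>2 * exp 1)"
    by (intro sums_mult exp_series)
  have tail: "\<bar>pair_expectation f a c b - c * F f 1 (a / 2) * F f 1 (b / 2)\<bar> \<le> c\<^sup>2 * L\<^sup>2 * exp 1"
    using norm_suminf_le[OF tb sums_summable[OF e]] e ts by (simp add: sums_iff)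
  have "\<bar>F f 1 (a / 2) * F f 1 (b / 2) - F f 1 (1 / 2) * F f 1 (1 / 2)\<bar>
      = \<bar>(F f 1 (a / 2) - F f 1 (1 / 2)) * F f 1 (b / 2)
         + F f 1 (1 / 2) * (F f 1 (b / 2) - F f 1 (1 / 2))\<bar>"
    by (simp add: algebra_simps)
  also have "\<dots> \<le> \<bar>(F f 1 (a / 2) - F f 1 (1 / 2)) * F f 1 (b / 2)\<bar>
         + \<bar>F f 1 (1 / 2) * (F f 1 (b / 2) - F f 1 (1 / 2))\<bar>"
    by (rule abs_triangle_ineq)
  also have "\<dots> \<le> L * \<bar>a - 1\<bar> * L + L * (L * \<bar>b - 1\<bar>)"
    unfolding abs_mult using L L0 Lip[OF a] Lip[OF b] by (intro add_mono mult_mono) auto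
  finally have "\<bar>F f 1 (a / 2) * F f 1 (b / 2) - lam f\<bar> \<le> L\<^sup>2 * (\<bar>a - 1\<bar> + \<bar>b - 1\<bar>)"
    by (simp add: lam_def power2_eq_square algebra_simps)
  from mult_left_mono[OF this, of "\<bar>c\<bar>"]
  have "\<bar>c * F f 1 (a / 2) * F f 1 (b / 2) - lam f * c\<bar> \<le> \<bar>c\<bar> * (L\<^sup>2 * (\<bar>a - 1\<bar> + \<bar>b - 1\<bar>))"
    by (simp add: algebra_simps flip: abs_mult)
  with tail have "\<bar>pair_expectation f a c b - lam f * c\<bar>
      \<le> c\<^sup>2 * L\<^sup>2 * exp 1 + \<bar>c\<bar> * (L\<^sup>2 * (\<bar>a - 1\<bar> + \<bar>b - 1\<bar>))"
    by linarith
  then show ?thesis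
    unfolding L_def[symmetric] by (simp add: algebra_simps)
qed

section \<open>Gaussian integrals\<close>

lemma nn_integral_exp_quadratic:
  fixes p h :: real
  assumes p: "p > 0"
  shows "(\<integral>\<^sup>+t. ennreal (exp (- (p * t\<^sup>2) / 2 + h * t)) \<partial>lborel)
    = ennreal (sqrt (2 * pi / p) * exp (h\<^sup>2 / (2 * p)))"
proof -
  define \<sigma> where "\<sigma> = 1 / sqrt p"
  have \<sigma>: "\<sigma> > 0" "\<sigma>\<^sup>2 = 1 / p"
    using p by (simp_all add: \<sigma>_def power_divide)
  let ?c = "sqrt (2 * pi / p) * exp (h\<^sup>2 / (2 * p))"
  have "exp (- (p * t\<^sup>2) / 2 + h * t) = ?c * normal_density (h / p) \<sigma> t" for t
  proof -
    have "- (p * t\<^sup>2) / 2 + h * t = h\<^sup>2 / (2 * p) + - ((t - h / p)\<^sup>2 / (2 * \<sigma>\<^sup>2))"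
      unfolding \<sigma>(2) using p by (simp add: power2_eq_square field_simps)
    then have e: "exp (- (p * t\<^sup>2) / 2 + h * t)
        = exp (h\<^sup>2 / (2 * p)) * exp (- ((t - h / p)\<^sup>2 / (2 * \<sigma>\<^sup>2)))"
      by (simp only: exp_add)
    show ?thesis
      unfolding e normal_density_def \<sigma>(2) using p by (simp add: real_sqrt_divide real_sqrt_mult)
  qed
  then have "(\<integral>\<^sup>+t. ennreal (exp (- (p * t\<^sup>2) / 2 + h * t)) \<partial>lborel)
      = (\<integral>\<^sup>+t. ennreal ?c * ennreal (normal_density (h / p) \<sigma> t) \<partial>lborel)"
    using p by (simp add: ennreal_mult)
  also have "\<dots> = ennreal ?c * (\<integral>\<^sup>+t. ennreal (normal_density (h / p) \<sigma> t) \<partial>lborel)"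
    by (intro nn_integral_cmult) simp
  also have "(\<integral>\<^sup>+t. ennreal (normal_density (h / p) \<sigma> t) \<partial>lborel) = 1"
    using \<sigma>(1) by (simp add: nn_integral_eq_integral)
  finally show ?thesis by simp
qed

text \<open>
  Eliminating the last row: the matrix is a unipotent upper block triangular matrix times a lower
  block triangular one whose diagonal blocks are the Schur complement and \<open>P n n\<close>.
\<close>
lemma det_Schur_complement:
  fixes P :: "nat \<Rightarrow> nat \<Rightarrow> real"
  assumes p: "P n n \<noteq> 0"
  shows "Determinant.det (Matrix.mat (Suc n) (Suc n) (\<lambda>(i, j). P i j))
    = P n n * Determinant.det (Matrix.mat n n (\<lambda>(i, j). P i j - P i n * P n j / P n n))"
proof -
  let ?U1 = "Matrix.mat n 1 (\<lambda>(i, j). P i n / P n n)"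
  let ?A = "Matrix.mat n n (\<lambda>(i, j). P i j - P i n * P n j / P n n)"
  let ?C = "Matrix.mat 1 n (\<lambda>(i, j). P n j)"
  let ?D = "Matrix.mat 1 1 (\<lambda>(i, j). P n n)"
  let ?U = "four_block_mat (1\<^sub>m n) ?U1 (0\<^sub>m 1 n) (1\<^sub>m 1)"
  let ?V = "four_block_mat ?A (0\<^sub>m n 1) ?C ?D"
  have "?U * ?V = four_block_mat (1\<^sub>m n * ?A + ?U1 * ?C) (1\<^sub>m n * 0\<^sub>m n 1 + ?U1 * ?D)
      (0\<^sub>m 1 n * ?A + 1\<^sub>m 1 * ?C) (0\<^sub>m 1 n * 0\<^sub>m n 1 + 1\<^sub>m 1 * ?D)"
    by (rule mult_four_block_mat[of _ n n _ 1 _ 1 _ _ n _ 1]) auto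
  also have "\<dots> = Matrix.mat (Suc n) (Suc n) (\<lambda>(i, j). P i j)"
    using p by (intro eq_matI) (auto simp: scalar_prod_def not_less less_Suc_eq)
  finally have "Determinant.det (Matrix.mat (Suc n) (Suc n) (\<lambda>(i, j). P i j))
      = Determinant.det ?U * Determinant.det ?V"
    by (subst det_mult[of _ "Suc n", symmetric]) auto
  also have "Determinant.det ?U = 1"
    by (subst det_four_block_mat_lower_left_zero[where n = n and m = 1]) auto
  also have "Determinant.det ?V = Determinant.det ?A * Determinant.det ?D"
    by (rule det_four_block_mat_upper_right_zero[where n = n and m = 1]) auto
  also have "Determinant.det ?D = P n n"
    by (simp add: det_single)
  finally show ?thesis by simp
qed

lemma quadratic_form_Suc:
  fixes P :: "nat \<Rightarrow> nat \<Rightarrow> real"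
  assumes sym: "\<And>i. i < n \<Longrightarrow> P i n = P n i"
  shows "(\<Sum>i<Suc n. \<Sum>j<Suc n. (x(n := t)) i * P i j * (x(n := t)) j)
    = (\<Sum>i<n. \<Sum>j<n. x i * P i j * x j) + 2 * t * (\<Sum>i<n. P n i * x i) + P n n * t\<^sup>2"
proof -
  have "(\<Sum>i<n. x i * P i n * t) = t * (\<Sum>i<n. P n i * x i)"
    using sym by (auto simp: sum_distrib_left mult_ac intro!: sum.cong)
  moreover have "(\<Sum>j<n. t * P n j * x j) = t * (\<Sum>i<n. P n i * x i)"
    by (simp add: sum_distrib_left mult_ac)
  ultimately show ?thesis
    by (simp add: sum.distrib power2_eq_square algebra_simps)
qed

text \<open>
  Induction on the dimension. Integrating out the last coordinate completes a square, replaces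
  \<open>P\<close> by its Schur complement and multiplies the value by \<open>sqrt (2 * pi / P n n)\<close>, which matches
  the effect on the determinant. The inverse of \<open>P\<close> enters only through a solution \<open>w\<close> of
  \<open>P w = b\<close>; its first \<open>n\<close> entries solve the reduced system, so no inverse has to be updated.
\<close>
lemma nn_integral_exp_quadratic_form:
  fixes P :: "nat \<Rightarrow> nat \<Rightarrow> real" and b w :: "nat \<Rightarrow> real"
  assumes "\<And>i j. i < d \<Longrightarrow> j < d \<Longrightarrow> P i j = P j i"
    and "\<And>x. \<exists>i<d. x i \<noteq> 0 \<Longrightarrow> 0 < (\<Sum>i<d. \<Sum>j<d. x i * P i j * x j)"
    and "\<And>i. i < d \<Longrightarrow> (\<Sum>j<d. P i j * w j) = b i"
  defines "D \<equiv> Determinant.det (Matrix.mat d d (\<lambda>(i, j). P i j))"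
  shows "0 < D \<and>
    (\<integral>\<^sup>+x. ennreal (exp (- (\<Sum>i<d. \<Sum>j<d. x i * P i j * x j) / 2 + (\<Sum>i<d. b i * x i)))
       \<partial>(\<Pi>\<^sub>M i\<in>{..<d}. lborel))
     = ennreal (sqrt ((2 * pi) ^ d / D) * exp ((\<Sum>i<d. b i * w i) / 2))"
  using assms(1-3) unfolding D_def
proof (induction d arbitrary: P b)
  case 0
  have "Determinant.det (Matrix.mat 0 0 (\<lambda>(i, j). P i j)) = 1"
    by (rule det_dim_zero) simp
  then show ?case
    by (simp add: PiM_empty nn_integral_count_space_finite)
next
  case (Suc n P b)
  interpret product_sigma_finite "\<lambda>_::nat. lborel :: real measure" ..
  define p where "p = P n n"
  have "0 < (\<Sum>i<Suc n. \<Sum>j<Suc n. ((\<lambda>_. 0)(n := 1)) i * P i j * ((\<lambda>_. 0)(n := 1)) j)"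
    by (rule Suc.prems(2)) auto
  then have p: "p > 0"
    by (simp add: p_def)
  have sym: "P i n = P n i" if "i < n" for i
    using Suc.prems(1) that by simp
  have QS: "(\<Sum>i<Suc n. \<Sum>j<Suc n. (x(n := t)) i * P i j * (x(n := t)) j)
    = (\<Sum>i<n. \<Sum>j<n. x i * P i j * x j) + 2 * t * (\<Sum>i<n. P n i * x i) + P n n * t\<^sup>2" for x t
    by (rule quadratic_form_Suc) (rule sym)
  define P' where "P' i j = P i j - P i n * P n j / p" for i j
  define b' where "b' i = b i - b n * P n i / p" for i
  define r where "r x = (\<Sum>i<n. P n i * x i)" for x
  have r2: "(\<Sum>i<n. \<Sum>j<n. x i * P' i j * x j) = (\<Sum>i<n. \<Sum>j<n. x i * P i j * x j) - (r x)\<^sup>2 / p" for x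
  proof -
    have "(r x)\<^sup>2 / p = (\<Sum>i<n. \<Sum>j<n. (P n i * x i) * (P n j * x j) / p)"
      by (simp add: r_def power2_eq_square sum_product sum_divide_distrib)
    also have "\<dots> = (\<Sum>i<n. \<Sum>j<n. x i * (P i n * P n j / p) * x j)"
      using sym by (intro sum.cong) auto
    finally show ?thesis
      by (simp add: P'_def algebra_simps sum_subtractf)
  qed
  have IH: "0 < Determinant.det (Matrix.mat n n (\<lambda>(i, j). P' i j)) \<and>
    (\<integral>\<^sup>+x. ennreal (exp (- (\<Sum>i<n. \<Sum>j<n. x i * P' i j * x j) / 2 + (\<Sum>i<n. b' i * x i)))
       \<partial>(\<Pi>\<^sub>M i\<in>{..<n}. lborel))
     = ennreal (sqrt ((2 * pi) ^ n / Determinant.det (Matrix.mat n n (\<lambda>(i, j). P' i j)))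
         * exp ((\<Sum>i<n. b' i * w i) / 2))"
  proof (rule Suc.IH)
    show "P' i j = P' j i" if "i < n" "j < n" for i j
      using that Suc.prems(1)[of i j] by (simp add: P'_def sym)
    show "0 < (\<Sum>i<n. \<Sum>j<n. x i * P' i j * x j)" if "\<exists>i<n. x i \<noteq> 0" for x
    proof -
      from that obtain i where i: "i < n" "x i \<noteq> 0" by blast
      \<comment> \<open>This last coordinate minimises the form, and the minimum is the value of the Schur complement.\<close>
      have "0 < (\<Sum>i<Suc n. \<Sum>j<Suc n. (x(n := - r x / p)) i * P i j * (x(n := - r x / p)) j)"
        using i by (intro Suc.prems(2) exI[of _ i]) auto
      then have "0 < (\<Sum>i<n. \<Sum>j<n. x i * P i j * x j) + (2 * (- r x / p) * r x + p * (- r x / p)\<^sup>2)"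
        unfolding QS r_def[symmetric] p_def[symmetric] by (simp only: add.assoc)
      also have "2 * (- r x / p) * r x + p * (- r x / p)\<^sup>2 = - ((r x)\<^sup>2 / p)"
        using p by (simp add: power2_eq_square field_simps)
      finally show ?thesis
        unfolding r2 by simp
    qed
    show "(\<Sum>j<n. P' i j * w j) = b' i" if "i < n" for i
    proof -
      have 1: "(\<Sum>j<n. P i j * w j) = b i - P i n * w n"
        using Suc.prems(3)[of i] that by simp
      have 2: "(\<Sum>j<n. P n j * w j) = b n - p * w n"
        using Suc.prems(3)[of n] by (simp add: p_def)
      have "(\<Sum>j<n. P' i j * w j) = (\<Sum>j<n. P i j * w j) - P i n / p * (\<Sum>j<n. P n j * w j)"
        by (simp add: P'_def algebra_simps sum_subtractf sum_distrib_left)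
      also have "\<dots> = b' i"
        unfolding 1 2 b'_def using p sym[OF that] by (simp add: field_simps)
      finally show ?thesis .
    qed
  qed
  define D' where "D' = Determinant.det (Matrix.mat n n (\<lambda>(i, j). P' i j))"
  have D: "Determinant.det (Matrix.mat (Suc n) (Suc n) (\<lambda>(i, j). P i j)) = p * D'"
    using det_Schur_complement[of P n] p by (simp add: p_def P'_def D'_def)
  have D'0: "0 < D'" using IH by (simp add: D'_def)
  let ?g = "\<lambda>d P b x. exp (- (\<Sum>i<d. \<Sum>j<d. x i * P i j * x j) / 2 + (\<Sum>i<d. b i * x i)) :: real"
  have meas: "(\<lambda>x. ennreal (?g k R c x)) \<in> borel_measurable (\<Pi>\<^sub>M i\<in>{..<k}. lborel)"
    for k c and R :: "nat \<Rightarrow> nat \<Rightarrow> real"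
    by measurable
  have inner: "(\<integral>\<^sup>+t. ennreal (?g (Suc n) P b (x(n := t))) \<partial>lborel)
      = ennreal (sqrt (2 * pi / p) * exp ((b n)\<^sup>2 / (2 * p))) * ennreal (?g n P' b' x)" for x
  proof -
    have "?g (Suc n) P b (x(n := t)) = exp (- (\<Sum>i<n. \<Sum>j<n. x i * P i j * x j) / 2 + (\<Sum>i<n. b i * x i))
        * exp (- (p * t\<^sup>2) / 2 + (b n - r x) * t)" for t
      unfolding QS exp_add[symmetric] r_def[symmetric] p_def[symmetric]
      by (simp add: field_simps)
    then have "(\<integral>\<^sup>+t. ennreal (?g (Suc n) P b (x(n := t))) \<partial>lborel)
        = ennreal (exp (- (\<Sum>i<n. \<Sum>j<n. x i * P i j * x j) / 2 + (\<Sum>i<n. b i * x i)))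
          * ennreal (sqrt (2 * pi / p) * exp ((b n - r x)\<^sup>2 / (2 * p)))"
      using nn_integral_exp_quadratic[OF p, of "b n - r x"]
      by (simp add: ennreal_mult nn_integral_cmult)
    also have "\<dots> = ennreal (sqrt (2 * pi / p) * exp ((b n)\<^sup>2 / (2 * p)) * ?g n P' b' x)"
    proof -
      have b'x: "(\<Sum>i<n. b' i * x i) = (\<Sum>i<n. b i * x i) - b n / p * r x"
        by (simp add: b'_def r_def algebra_simps sum_subtractf sum_distrib_left)
      have "- (\<Sum>i<n. \<Sum>j<n. x i * P i j * x j) / 2 + (\<Sum>i<n. b i * x i) + (b n - r x)\<^sup>2 / (2 * p)
          = (b n)\<^sup>2 / (2 * p) + (- (\<Sum>i<n. \<Sum>j<n. x i * P' i j * x j) / 2 + (\<Sum>i<n. b' i * x i))"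
        unfolding r2 b'x using p by (simp add: power2_eq_square field_simps)
      from arg_cong[OF this, of exp] show ?thesis
        by (simp only: exp_add ennreal_mult[symmetric] mult_ac) (simp add: p less_imp_le mult_ac flip: ennreal_mult)
    qed
    finally show ?thesis
      by (simp add: ennreal_mult p less_imp_le)
  qed
  have "(\<integral>\<^sup>+x. ennreal (?g (Suc n) P b x) \<partial>(\<Pi>\<^sub>M i\<in>{..<Suc n}. lborel))
      = (\<integral>\<^sup>+x. \<integral>\<^sup>+t. ennreal (?g (Suc n) P b (x(n := t))) \<partial>lborel \<partial>(\<Pi>\<^sub>M i\<in>{..<n}. lborel))"
  proof -
    have "(\<lambda>x. ennreal (?g (Suc n) P b x)) \<in> borel_measurable (\<Pi>\<^sub>M i\<in>insert n {..<n}. lborel)"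
      unfolding lessThan_Suc[symmetric] by (rule meas)
    from product_nn_integral_insert[OF _ _ this] show ?thesis
      by (simp only: lessThan_Suc[symmetric]) simp
  qed
  also have "\<dots> = ennreal (sqrt (2 * pi / p) * exp ((b n)\<^sup>2 / (2 * p)))
      * ennreal (sqrt ((2 * pi) ^ n / D') * exp ((\<Sum>i<n. b' i * w i) / 2))"
    unfolding inner nn_integral_cmult[OF meas] D'_def IH[THEN conjunct2] ..
  also have "\<dots> = ennreal (sqrt ((2 * pi) ^ Suc n / (p * D')) * exp ((\<Sum>i<Suc n. b i * w i) / 2))"
  proof -
    have "sqrt (2 * pi / p) * sqrt ((2 * pi) ^ n / D') = sqrt ((2 * pi) ^ Suc n / (p * D'))"
      by (simp flip: real_sqrt_mult)
    moreover have "exp ((b n)\<^sup>2 / (2 * p)) * exp ((\<Sum>i<n. b' i * w i) / 2) = exp ((\<Sum>i<Suc n. b i * w i) / 2)"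
    proof -
      have "(\<Sum>j<n. P n j * w j) = b n - p * w n"
        using Suc.prems(3)[of n] by (simp add: p_def)
      then have "(\<Sum>i<n. b' i * w i) = (\<Sum>i<n. b i * w i) - b n / p * (b n - p * w n)"
        by (simp add: b'_def algebra_simps sum_subtractf sum_distrib_left flip: \<open>_ = b n - p * w n\<close>)
      then show ?thesis
        using p by (simp add: power2_eq_square field_simps flip: exp_add)
    qed
    ultimately show ?thesis
      by (simp add: mult_ac less_imp_le[OF p] less_imp_le[OF D'0] flip: ennreal_mult)
  qed
  finally show ?case
    using p D'0 by (simp only: D mult_pos_pos simp_thms)
qed


lemma mult_mat_vec_index:
  fixes A :: "real mat"
  assumes "A \<in> carrier_mat n n" "v \<in> carrier_vec n" "i < n"
  shows "vec_index (A *\<^sub>v v) i = (\<Sum>j<n. A $$ (i, j) * vec_index v j)"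
  using assms by (auto simp: scalar_prod_def atLeast0LessThan intro!: sum.cong)

lemma gaussian_exp_linear:
  fixes S P :: "real mat" and b :: "nat \<Rightarrow> real"
  assumes S: "S \<in> carrier_mat d d" and inv: "mat_inverse S = Some P"
    and sym: "transpose_mat P = P"
    and pd: "\<And>v. v \<in> carrier_vec d \<Longrightarrow> v \<noteq> 0\<^sub>v d \<Longrightarrow> 0 < scalar_prod v (P *\<^sub>v v)"
  shows "has_bochner_integral (gaussian d S) (\<lambda>x. exp (\<Sum>i<d. b i * x i))
    (exp ((\<Sum>i<d. \<Sum>j<d. b i * S $$ (i, j) * b j) / 2))"
proof -
  have PS: "S * P = 1\<^sub>m d" "P * S = 1\<^sub>m d" and P: "P \<in> carrier_mat d d"
    using mat_inverse(2)[OF S inv] by auto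
  define w where "w i = (\<Sum>j<d. S $$ (i, j) * b j)" for i
  define D where "D = Determinant.det P"
  define Q where "Q x = (\<Sum>i<d. \<Sum>j<d. x i * P $$ (i, j) * x j)" for x
  have Q: "scalar_prod (Matrix.vec d x) (P *\<^sub>v Matrix.vec d x) = Q x" for x
  proof -
    have "scalar_prod (Matrix.vec d x) (P *\<^sub>v Matrix.vec d x)
        = (\<Sum>i<d. x i * vec_index (P *\<^sub>v Matrix.vec d x) i)"
      using P by (auto simp: scalar_prod_def atLeast0LessThan intro!: sum.cong)
    also have "\<dots> = Q x"
      unfolding Q_def using P
      by (intro sum.cong refl)
        (simp add: mult_mat_vec_index[of P d] sum_distrib_left mult_ac del: index_mult_mat_vec)
    finally show ?thesis .
  qed
  have "Matrix.mat d d (\<lambda>(i, j). P $$ (i, j)) = P"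
    using P by (intro eq_matI) auto
  moreover have "P $$ (i, j) = P $$ (j, i)" if "i < d" "j < d" for i j
    using that P arg_cong[OF sym, of "\<lambda>A. A $$ (i, j)"] by simp
  moreover have "0 < (\<Sum>i<d. \<Sum>j<d. x i * P $$ (i, j) * x j)" if "\<exists>i<d. x i \<noteq> 0" for x
  proof -
    have "Matrix.vec d x \<noteq> 0\<^sub>v d"
      using that by (metis index_vec index_zero_vec(1))
    then show ?thesis
      using pd[of "Matrix.vec d x"] by (simp add: Q) (simp add: Q_def)
  qed
  moreover have "(\<Sum>j<d. P $$ (i, j) * w j) = b i" if "i < d" for i
  proof -
    have "(\<Sum>j<d. P $$ (i, j) * w j) = (\<Sum>k<d. (\<Sum>j<d. P $$ (i, j) * S $$ (j, k)) * b k)"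
      unfolding w_def sum_distrib_left sum_distrib_right by (subst sum.swap) (simp add: mult_ac)
    also have "\<dots> = (\<Sum>k<d. (P * S) $$ (i, k) * b k)"
      using S P that by (auto simp: scalar_prod_def atLeast0LessThan intro!: sum.cong)
    also have "\<dots> = (\<Sum>k<d. if k = i then b k else 0)"
      using that unfolding PS by (intro sum.cong) auto
    finally show ?thesis using that by simp
  qed
  ultimately have *: "0 < D"
    "(\<integral>\<^sup>+x. ennreal (exp (- Q x / 2 + (\<Sum>i<d. b i * x i))) \<partial>(\<Pi>\<^sub>M i\<in>{..<d}. lborel))
     = ennreal (sqrt ((2 * pi) ^ d / D) * exp ((\<Sum>i<d. b i * w i) / 2))"
    using nn_integral_exp_quadratic_form[of d "\<lambda>i j. P $$ (i, j)" w b]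
    unfolding Q_def D_def by auto
  have "Determinant.det S * D = 1"
    using det_mult[OF S P] PS by (simp add: D_def)
  then have dS: "Determinant.det S = 1 / D"
    using *(1) by (simp add: field_simps)
  define Z where "Z = sqrt ((2 * pi) ^ d / D)"
  have Z: "Z > 0"
    using *(1) by (simp add: Z_def)
  have dens: "gaussian_density d S x = exp (- Q x / 2) / Z" for x
    unfolding gaussian_density_def by (simp add: inv Q dS Z_def)
  have Qm[measurable]: "Q \<in> borel_measurable (\<Pi>\<^sub>M i\<in>{..<d}. lborel)"
    unfolding Q_def by measurable
  have lin[measurable]: "(\<lambda>x. \<Sum>i<d. b i * x i) \<in> borel_measurable (\<Pi>\<^sub>M i\<in>{..<d}. lborel)"
    by measurable
  show ?thesis
  proof (rule has_bochner_integral_nn_integral)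
    show "(\<lambda>x. exp (\<Sum>i<d. b i * x i)) \<in> borel_measurable (gaussian d S)"
      unfolding gaussian_def by measurable
    have "(\<integral>\<^sup>+x. ennreal (exp (\<Sum>i<d. b i * x i)) \<partial>gaussian d S)
        = (\<integral>\<^sup>+x. ennreal (1 / Z) * ennreal (exp (- Q x / 2 + (\<Sum>i<d. b i * x i)))
             \<partial>(\<Pi>\<^sub>M i\<in>{..<d}. lborel))"
    proof -
      have "ennreal (exp (- Q x / 2) / Z) * ennreal (exp l) = ennreal (1 / Z) * ennreal (exp (- Q x / 2 + l))"
        for x l
        unfolding exp_add using Z by (simp flip: ennreal_mult)
      then show ?thesis
        unfolding gaussian_def dens by (subst nn_integral_density) auto
    qed
    also have "\<dots> = ennreal (1 / Z) * ennreal (Z * exp ((\<Sum>i<d. b i * w i) / 2))"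
    proof (subst nn_integral_cmult)
      show "(\<lambda>x. ennreal (exp (- Q x / 2 + (\<Sum>i<d. b i * x i)))) \<in> borel_measurable (\<Pi>\<^sub>M i\<in>{..<d}. lborel)"
        by measurable
    qed (simp only: *(2) Z_def)
    also have "\<dots> = ennreal (exp ((\<Sum>i<d. b i * w i) / 2))"
      using Z by (simp flip: ennreal_mult)
    also have "(\<Sum>i<d. b i * w i) = (\<Sum>i<d. \<Sum>j<d. b i * S $$ (i, j) * b j)"
      by (simp add: w_def sum_distrib_left mult.assoc)
    finally show "(\<integral>\<^sup>+x. ennreal (exp (\<Sum>i<d. b i * x i)) \<partial>gaussian d S)
        = ennreal (exp ((\<Sum>i<d. \<Sum>j<d. b i * S $$ (i, j) * b j) / 2))" .
  qed auto
qed

lemma gaussian_exp_pair: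
  fixes S P :: "real mat"
  assumes S: "S \<in> carrier_mat d d" and inv: "mat_inverse S = Some P"
    and sym: "transpose_mat P = P"
    and pd: "\<And>v. v \<in> carrier_vec d \<Longrightarrow> v \<noteq> 0\<^sub>v d \<Longrightarrow> 0 < scalar_prod v (P *\<^sub>v v)"
    and Ssym: "S $$ (i, j) = S $$ (j, i)" and i: "i < d" and j: "j < d"
  shows "has_bochner_integral (gaussian d S) (\<lambda>x. exp (s * x i + t * x j))
    (exp (S $$ (i, i) / 2 * s\<^sup>2 + S $$ (i, j) * s * t + S $$ (j, j) / 2 * t\<^sup>2))"
proof -
  \<comment> \<open>Adding the two indicators keeps the formula valid for \<open>i = j\<close>.\<close>
  define b where "b k = (if k = i then s else 0) + (if k = j then t else 0)" for k
  have lin: "(\<Sum>k<d. b k * u k) = s * u i + t * u j" for u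
    using i j by (simp add: b_def distrib_right sum.distrib if_distrib[of "\<lambda>x. x * u _"] cong: if_cong)
  have "(\<Sum>k<d. \<Sum>l<d. b k * S $$ (k, l) * b l) = (\<Sum>k<d. b k * (\<Sum>l<d. b l * S $$ (k, l)))"
    by (simp add: sum_distrib_left mult_ac)
  also have "\<dots> / 2 = S $$ (i, i) / 2 * s\<^sup>2 + S $$ (i, j) * s * t + S $$ (j, j) / 2 * t\<^sup>2"
    unfolding lin using Ssym by (simp add: power2_eq_square field_simps)
  finally have "(\<Sum>k<d. \<Sum>l<d. b k * S $$ (k, l) * b l) / 2
    = S $$ (i, i) / 2 * s\<^sup>2 + S $$ (i, j) * s * t + S $$ (j, j) / 2 * t\<^sup>2" .
  moreover have "has_bochner_integral (gaussian d S) (\<lambda>x. exp (\<Sum>k<d. b k * x k))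
      (exp ((\<Sum>k<d. \<Sum>l<d. b k * S $$ (k, l) * b l) / 2))"
    by (rule gaussian_exp_linear[OF S inv sym]) (rule pd)
  ultimately show ?thesis
    by (simp only: lin)
qed

section \<open>Operator bounds and Neumann estimates\<close>

lemma euclid_norm_eq: "v \<in> carrier_vec d \<Longrightarrow> euclid_norm v = L2_set (vec_index v) {..<d}"
  by (auto simp: euclid_norm_def)

lemma euclid_norm_nonneg: "0 \<le> euclid_norm v"
  by (simp add: euclid_norm_def)

lemma euclid_norm_add:
  assumes "u \<in> carrier_vec d" "v \<in> carrier_vec d"
  shows "euclid_norm (u + v) \<le> euclid_norm u + euclid_norm v"
proof -
  have "euclid_norm (u + v) = L2_set (\<lambda>i. vec_index u i + vec_index v i) {..<d}"
    using assms by (subst euclid_norm_eq[of _ d]) (auto intro: L2_set_cong)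
  then show ?thesis
    using L2_set_triangle_ineq[of "vec_index u" "vec_index v" "{..<d}"] assms
    by (simp add: euclid_norm_eq[of _ d])
qed

lemma euclid_norm_smult: "euclid_norm (c \<cdot>\<^sub>v v) = \<bar>c\<bar> * euclid_norm v"
proof -
  have "euclid_norm (c \<cdot>\<^sub>v v) = L2_set (\<lambda>i. c * vec_index v i) {..<dim_vec v}"
    unfolding euclid_norm_def by (intro L2_set_cong) auto
  also have "\<dots> = \<bar>c\<bar> * L2_set (vec_index v) {..<dim_vec v}"
    by (simp add: L2_set_def power_mult_distrib real_sqrt_mult flip: sum_distrib_left)
  finally show ?thesis by (simp add: euclid_norm_def)
qed

lemma abs_index_le_euclid_norm: "i < dim_vec v \<Longrightarrow> \<bar>vec_index v i\<bar> \<le> euclid_norm v"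
  using member_le_L2_set[of "{..<dim_vec v}" i "\<lambda>i. \<bar>vec_index v i\<bar>"]
  by (simp add: euclid_norm_def L2_set_def)

lemma euclid_norm_eq_0:
  assumes "v \<in> carrier_vec d" "euclid_norm v = 0"
  shows "v = 0\<^sub>v d"
  using assms abs_index_le_euclid_norm[of _ v] by (intro eq_vecI) auto

lemma scalar_prod_self: "scalar_prod v v = (euclid_norm v)\<^sup>2"
  by (simp add: euclid_norm_def L2_set_def scalar_prod_def sum_nonneg atLeast0LessThan power2_eq_square)

lemma abs_scalar_prod_le:
  assumes "u \<in> carrier_vec d" "v \<in> carrier_vec d"
  shows "\<bar>scalar_prod u v\<bar> \<le> euclid_norm u * euclid_norm v"
proof -
  have "\<bar>scalar_prod u v\<bar> \<le> (\<Sum>i<d. \<bar>vec_index u i\<bar> * \<bar>vec_index v i\<bar>)"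
    using assms by (auto simp: scalar_prod_def atLeast0LessThan abs_mult intro!: order_trans[OF sum_abs])
  also have "\<dots> \<le> euclid_norm u * euclid_norm v"
    using L2_set_mult_ineq[of "vec_index u" "vec_index v" "{..<d}"] assms
    by (simp add: euclid_norm_eq[of _ d])
  finally show ?thesis .
qed

text \<open>
  The inequality \<open>op_norm A \<le> c\<close> for a square matrix and \<open>c \<ge> 0\<close>, in a form that composes without
  suprema.
\<close>
definition op_bound :: "nat \<Rightarrow> real mat \<Rightarrow> real \<Rightarrow> bool" where
  "op_bound d A c \<longleftrightarrow> A \<in> carrier_mat d d \<and>
     (\<forall>v \<in> carrier_vec d. euclid_norm (A *\<^sub>v v) \<le> c * euclid_norm v)"

lemma op_boundI:
  assumes "A \<in> carrier_mat d d" "\<And>v. v \<in> carrier_vec d \<Longrightarrow> euclid_norm (A *\<^sub>v v) \<le> c * euclid_norm v"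
  shows "op_bound d A c"
  using assms by (simp add: op_bound_def)

lemma op_boundD:
  assumes "op_bound d A c"
  shows "A \<in> carrier_mat d d" "v \<in> carrier_vec d \<Longrightarrow> euclid_norm (A *\<^sub>v v) \<le> c * euclid_norm v"
  using assms by (auto simp: op_bound_def)

lemma op_bound_mono: "op_bound d A c \<Longrightarrow> c \<le> c' \<Longrightarrow> op_bound d A c'"
  unfolding op_bound_def by (meson euclid_norm_nonneg mult_right_mono order_trans)

lemma op_bound_add:
  assumes "op_bound d A a" "op_bound d B b"
  shows "op_bound d (A + B) (a + b)"
proof (rule op_boundI)
  note AB = op_boundD[OF assms(1)] op_boundD[OF assms(2)]
  show "A + B \<in> carrier_mat d d" using AB by auto
  fix v :: "real vec" assume v: "v \<in> carrier_vec d"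
  have "euclid_norm ((A + B) *\<^sub>v v) \<le> euclid_norm (A *\<^sub>v v) + euclid_norm (B *\<^sub>v v)"
    unfolding add_mult_distrib_mat_vec[OF AB(1,3) v] using AB v by (intro euclid_norm_add[of _ d]) auto
  then show "euclid_norm ((A + B) *\<^sub>v v) \<le> (a + b) * euclid_norm v"
    using AB(2)[OF v] AB(4)[OF v] by (simp add: distrib_right)
qed

lemma op_bound_smult:
  assumes "op_bound d A a"
  shows "op_bound d (c \<cdot>\<^sub>m A) (\<bar>c\<bar> * a)"
proof (rule op_boundI)
  note A = op_boundD[OF assms]
  show "c \<cdot>\<^sub>m A \<in> carrier_mat d d" using A by auto
  fix v :: "real vec" assume v: "v \<in> carrier_vec d"
  have "(c \<cdot>\<^sub>m A) *\<^sub>v v = c \<cdot>\<^sub>v (A *\<^sub>v v)"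
    using A v by (intro eq_vecI) (auto simp: scalar_prod_def sum_distrib_left mult_ac)
  then show "euclid_norm ((c \<cdot>\<^sub>m A) *\<^sub>v v) \<le> \<bar>c\<bar> * a * euclid_norm v"
    using mult_left_mono[OF A(2)[OF v], of "\<bar>c\<bar>"] by (simp add: euclid_norm_smult)
qed

lemma op_bound_mult:
  assumes "op_bound d A a" "op_bound d B b" "0 \<le> a"
  shows "op_bound d (A * B) (a * b)"
proof (rule op_boundI)
  note AB = op_boundD[OF assms(1)] op_boundD[OF assms(2)]
  show "A * B \<in> carrier_mat d d" using AB by auto
  fix v :: "real vec" assume v: "v \<in> carrier_vec d"
  have Bv: "B *\<^sub>v v \<in> carrier_vec d" using AB v by auto
  have "euclid_norm ((A * B) *\<^sub>v v) \<le> a * euclid_norm (B *\<^sub>v v)"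
    unfolding assoc_mult_mat_vec[OF AB(1,3) v] by (rule AB(2)[OF Bv])
  also have "\<dots> \<le> a * (b * euclid_norm v)"
    by (intro mult_left_mono AB(4) v assms(3))
  finally show "euclid_norm ((A * B) *\<^sub>v v) \<le> a * b * euclid_norm v"
    by (simp add: mult.assoc)
qed

lemma op_bound_entry:
  assumes A: "op_bound d A c" and i: "i < d" and j: "j < d"
  shows "\<bar>A $$ (i, j)\<bar> \<le> c"
proof -
  have "euclid_norm (unit_vec d j :: real vec) = sqrt (\<Sum>k<d. if k = j then 1 else 0)"
    unfolding euclid_norm_def L2_set_def
    by (intro arg_cong[where f = sqrt] sum.cong) (auto simp: unit_vec_def)
  then have u: "euclid_norm (unit_vec d j :: real vec) = 1"
    using j by simp
  have "\<bar>A $$ (i, j)\<bar> = \<bar>vec_index (A *\<^sub>v unit_vec d j) i\<bar>"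
    using op_boundD(1)[OF A] i j by simp
  also have "\<dots> \<le> euclid_norm (A *\<^sub>v unit_vec d j)"
    using op_boundD(1)[OF A] i by (intro abs_index_le_euclid_norm) auto
  also have "\<dots> \<le> c"
    using op_boundD(2)[OF A, of "unit_vec d j"] u by simp
  finally show ?thesis .
qed

lemma op_bound_Frobenius:
  fixes A :: "real mat"
  assumes A: "A \<in> carrier_mat d d"
  shows "op_bound d A (L2_set (\<lambda>i. L2_set (\<lambda>j. A $$ (i, j)) {..<d}) {..<d})"
proof (rule op_boundI[OF A])
  fix v :: "real vec" assume v: "v \<in> carrier_vec d"
  have entry: "\<bar>vec_index (A *\<^sub>v v) i\<bar> \<le> L2_set (\<lambda>j. A $$ (i, j)) {..<d} * euclid_norm v" if "i < d" for i
  proof -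
    have "vec_index (A *\<^sub>v v) i = scalar_prod (row A i) v"
      using A that by simp
    moreover have "euclid_norm (row A i) = L2_set (\<lambda>j. A $$ (i, j)) {..<d}"
      using A that by (auto simp: euclid_norm_def intro!: L2_set_cong)
    ultimately show ?thesis
      using abs_scalar_prod_le[of "row A i" d v] A v by auto
  qed
  have "euclid_norm (A *\<^sub>v v) = L2_set (\<lambda>i. \<bar>vec_index (A *\<^sub>v v) i\<bar>) {..<d}"
    using A v by (subst euclid_norm_eq[of _ d]) (auto simp: L2_set_def)
  also have "\<dots> \<le> L2_set (\<lambda>i. L2_set (\<lambda>j. A $$ (i, j)) {..<d} * euclid_norm v) {..<d}"
    by (rule L2_set_mono) (use entry in auto)
  also have "\<dots> = L2_set (\<lambda>i. L2_set (\<lambda>j. A $$ (i, j)) {..<d}) {..<d} * euclid_norm v"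
    by (rule L2_set_left_distrib[symmetric]) (rule euclid_norm_nonneg)
  finally show "euclid_norm (A *\<^sub>v v)
      \<le> L2_set (\<lambda>i. L2_set (\<lambda>j. A $$ (i, j)) {..<d}) {..<d} * euclid_norm v" .
qed

text \<open>
  An entrywise bound \<open>O(\<epsilon>\<^sup>2)\<close> costs a factor \<open>d\<close> as an operator bound. This loss is where the
  hypothesis that \<open>d * \<epsilon>\<close> is bounded is needed.
\<close>
lemma op_bound_of_entries:
  assumes A: "A \<in> carrier_mat d d" and g: "\<And>i j. i < d \<Longrightarrow> j < d \<Longrightarrow> \<bar>A $$ (i, j)\<bar> \<le> g"
    and g0: "0 \<le> g"
  shows "op_bound d A (real d * g)"
proof (rule op_bound_mono[OF op_bound_Frobenius[OF A]])
  have "L2_set (\<lambda>j. A $$ (i, j)) {..<d} \<le> sqrt (real d) * g" if "i < d" for i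
  proof -
    have "L2_set (\<lambda>j. A $$ (i, j)) {..<d} = L2_set (\<lambda>j. \<bar>A $$ (i, j)\<bar>) {..<d}"
      by (simp add: L2_set_def)
    also have "\<dots> \<le> L2_set (\<lambda>j. g) {..<d}"
      by (rule L2_set_mono) (use g that in auto)
    finally show ?thesis using g0 by (simp add: L2_set_constant)
  qed
  then have "L2_set (\<lambda>i. L2_set (\<lambda>j. A $$ (i, j)) {..<d}) {..<d}
      \<le> L2_set (\<lambda>i. sqrt (real d) * g) {..<d}"
    by (intro L2_set_mono) auto
  also have "\<dots> = real d * g"
    using g0 by (simp add: L2_set_constant)
  finally show "L2_set (\<lambda>i. L2_set (\<lambda>j. A $$ (i, j)) {..<d}) {..<d} \<le> real d * g" .
qed

lemma op_bound_op_norm: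
  assumes A: "A \<in> carrier_mat d d"
  shows "op_bound d A (op_norm A)"
proof (rule op_boundI[OF A])
  fix v :: "real vec" assume v: "v \<in> carrier_vec d"
  define c where "c = L2_set (\<lambda>i. L2_set (\<lambda>j. A $$ (i, j)) {..<d}) {..<d}"
  have c: "op_bound d A c" "0 \<le> c"
    using op_bound_Frobenius[OF A] by (auto simp: c_def)
  show "euclid_norm (A *\<^sub>v v) \<le> op_norm A * euclid_norm v"
  proof (cases "euclid_norm v = 0")
    case True
    then show ?thesis using op_boundD(2)[OF c(1) v] by simp
  next
    case False
    define r where "r = euclid_norm v"
    have r: "r > 0" using False euclid_norm_nonneg[of v] by (simp add: r_def)
    let ?u = "(1 / r) \<cdot>\<^sub>v v"
    have "bdd_above ((\<lambda>v. euclid_norm (A *\<^sub>v v)) ` {v \<in> carrier_vec (dim_col A). euclid_norm v \<le> 1})"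
    proof (rule bdd_aboveI2)
      fix w assume "w \<in> {v \<in> carrier_vec (dim_col A). euclid_norm v \<le> 1}"
      then have "w \<in> carrier_vec d" "euclid_norm w \<le> 1" using A by auto
      then show "euclid_norm (A *\<^sub>v w) \<le> c"
        using op_boundD(2)[OF c(1), of w] mult_left_mono[of "euclid_norm w" 1 c] c(2) by simp
    qed
    moreover have "?u \<in> {v \<in> carrier_vec (dim_col A). euclid_norm v \<le> 1}"
      using A v r by (simp add: euclid_norm_smult r_def)
    ultimately have "euclid_norm (A *\<^sub>v ?u) \<le> op_norm A"
      unfolding op_norm_def by (rule cSUP_upper[rotated])
    moreover have "A *\<^sub>v ?u = (1 / r) \<cdot>\<^sub>v (A *\<^sub>v v)"
      using A v by (intro mult_mat_vec) auto
    ultimately show ?thesis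
      using r by (simp add: euclid_norm_smult r_def[symmetric] field_simps)
  qed
qed

lemma mat_inverse_SomeI:
  fixes A N :: "real mat"
  assumes A: "A \<in> carrier_mat d d" and N: "N \<in> carrier_mat d d"
    and AN: "A * N = 1\<^sub>m d" and NA: "N * A = 1\<^sub>m d"
  shows "mat_inverse A = Some N"
proof (cases "mat_inverse A")
  case None
  have "A \<in> Units (ring_mat TYPE(real) d ())"
    using assms by (auto simp: Units_def ring_mat_def)
  with mat_inverse(1)[OF A None, of "()"] show ?thesis by simp
next
  case (Some M)
  from mat_inverse(2)[OF A Some] have M: "A * M = 1\<^sub>m d" "M \<in> carrier_mat d d" by auto
  have "M = (N * A) * M" using M NA by simp
  also have "\<dots> = N * (A * M)" using N A M by (intro assoc_mult_mat) auto
  finally show ?thesis using Some M N by simp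
qed

lemma op_bound_imp_invertible:
  assumes A: "op_bound d A q" and q: "q < 1"
  obtains N where "N \<in> carrier_mat d d" "(1\<^sub>m d - A) * N = 1\<^sub>m d" "N * (1\<^sub>m d - A) = 1\<^sub>m d"
proof -
  note Ac = op_boundD(1)[OF A]
  have c: "1\<^sub>m d - A \<in> carrier_mat d d" using Ac by auto
  have "Determinant.det (1\<^sub>m d - A) \<noteq> 0"
  proof
    assume "Determinant.det (1\<^sub>m d - A) = 0"
    then obtain v where v: "v \<in> carrier_vec d" "v \<noteq> 0\<^sub>v d" "(1\<^sub>m d - A) *\<^sub>v v = 0\<^sub>v d"
      using det_0_iff_vec_prod_zero_field[OF c] by auto
    have "(1\<^sub>m d - A) *\<^sub>v v = v - A *\<^sub>v v"
      unfolding minus_mult_distrib_mat_vec[OF one_carrier_mat Ac v(1)] using v by simp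
    then have z: "v - A *\<^sub>v v = 0\<^sub>v d" using v(3) by simp
    have "v = A *\<^sub>v v"
    proof (rule eq_vecI)
      fix i assume "i < dim_vec (A *\<^sub>v v)"
      then show "vec_index v i = vec_index (A *\<^sub>v v) i"
        using arg_cong[OF z, of "\<lambda>u. vec_index u i"] Ac v(1) by simp
    qed (use Ac v(1) in auto)
    then have "euclid_norm v \<le> q * euclid_norm v"
      using op_boundD(2)[OF A v(1)] by simp
    then have "(1 - q) * euclid_norm v \<le> 0" by (simp add: algebra_simps)
    with q have "euclid_norm v = 0"
      using euclid_norm_nonneg[of v] by (simp add: mult_le_0_iff)
    with v show False using euclid_norm_eq_0 by blast
  qed
  from det_non_zero_imp_unit[OF c this, of "()"] that show thesis
    by (auto simp: Units_def ring_mat_def)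
qed

text \<open>
  \<open>N = I + A + A\<^sup>2 N\<close> with \<open>\<parallel>N\<parallel> \<le> 1 / (1 - q)\<close>, and entries are bounded by the operator norm. No
  factor \<open>d\<close> appears here, so the estimates are uniform in the dimension.
\<close>
lemma Neumann_estimates:
  assumes A: "op_bound d A q" and q0: "0 \<le> q" and q1: "q < 1"
    and N: "N \<in> carrier_mat d d" and AN: "(1\<^sub>m d - A) * N = 1\<^sub>m d"
    and i: "i < d" and j: "j < d"
  shows "\<bar>N $$ (i, j) - 1\<^sub>m d $$ (i, j)\<bar> \<le> q / (1 - q)"
    and "\<bar>N $$ (i, j) - 1\<^sub>m d $$ (i, j) - A $$ (i, j)\<bar> \<le> q\<^sup>2 / (1 - q)"
proof -
  note Ac = op_boundD(1)[OF A]
  have "(1\<^sub>m d - A) * N = N - A * N"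
    unfolding minus_mult_distrib_mat[OF one_carrier_mat Ac N] using N by simp
  then have NAN: "N - A * N = 1\<^sub>m d" using AN by simp
  have N1: "N = 1\<^sub>m d + A * N"
    using N Ac by (subst NAN[symmetric]) (intro eq_matI, auto)
  have AN1: "A * N = A + A * (A * N)"
  proof -
    have "A * N = A * (1\<^sub>m d + A * N)" using N1 by simp
    also have "\<dots> = A * 1\<^sub>m d + A * (A * N)"
      using Ac N by (intro mult_add_distrib_mat) auto
    finally show ?thesis using Ac by simp
  qed
  have "op_bound d N (1 / (1 - q))"
  proof (rule op_boundI[OF N])
    fix u :: "real vec" assume u: "u \<in> carrier_vec d"
    have Nu: "N *\<^sub>v u \<in> carrier_vec d" using N u by auto
    have "N *\<^sub>v u = (1\<^sub>m d + A * N) *\<^sub>v u" using N1 by simp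
    also have "\<dots> = 1\<^sub>m d *\<^sub>v u + (A * N) *\<^sub>v u"
      using Ac N u by (intro add_mult_distrib_mat_vec) auto
    also have "\<dots> = u + A *\<^sub>v (N *\<^sub>v u)"
      using Ac N u by simp
    finally have "euclid_norm (N *\<^sub>v u) \<le> euclid_norm u + euclid_norm (A *\<^sub>v (N *\<^sub>v u))"
      using euclid_norm_add[of u d "A *\<^sub>v (N *\<^sub>v u)"] u Ac Nu by auto
    also have "\<dots> \<le> euclid_norm u + q * euclid_norm (N *\<^sub>v u)"
      using op_boundD(2)[OF A Nu] by simp
    finally show "euclid_norm (N *\<^sub>v u) \<le> 1 / (1 - q) * euclid_norm u"
      using q1 by (simp add: field_simps)
  qed
  from op_bound_mult[OF A this q0] have b1: "op_bound d (A * N) (q / (1 - q))" by simp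
  from op_bound_mult[OF A this q0] have b2: "op_bound d (A * (A * N)) (q\<^sup>2 / (1 - q))"
    by (simp add: power2_eq_square)
  have "N $$ (i, j) = 1\<^sub>m d $$ (i, j) + (A * N) $$ (i, j)"
    by (subst N1) (use i j Ac N in simp)
  moreover have "(A * N) $$ (i, j) = A $$ (i, j) + (A * (A * N)) $$ (i, j)"
    by (subst AN1) (use i j Ac N in simp)
  ultimately show "\<bar>N $$ (i, j) - 1\<^sub>m d $$ (i, j)\<bar> \<le> q / (1 - q)"
    and "\<bar>N $$ (i, j) - 1\<^sub>m d $$ (i, j) - A $$ (i, j)\<bar> \<le> q\<^sup>2 / (1 - q)"
    using op_bound_entry[OF b1 i j] op_bound_entry[OF b2 i j] by auto
qed

section \<open>The covariance matrix and its inverse\<close>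

text \<open>
  \<open>kappa f\<close> is the second moment of \<open>f(Z)\<close> for a standard normal \<open>Z\<close>, which can vanish only if the
  continuous function \<open>f\<close> is zero almost everywhere, hence everywhere.
\<close>
lemma kappa_pos:
  fixes f :: "real \<Rightarrow> real"
  assumes odd: "\<And>x. f (- x) = - f x"
    and taylor: "\<And>x. (\<lambda>k. deriv0 f k / fact k * x ^ k) sums f x"
    and bound: "\<And>k. \<bar>deriv0 f k\<bar> \<le> M"
    and nz: "f x0 \<noteq> 0"
  shows "kappa f > 0"
proof -
  define N where "N = density lborel (\<lambda>x. ennreal (std_normal_density x))"
  have cont: "continuous_on UNIV f"
  proof -
    have "f = (\<lambda>x. \<Sum>k. deriv0 f k / fact k * x ^ k)"
      using taylor by (simp add: sums_iff fun_eq_iff)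
    moreover have "isCont (\<lambda>x. \<Sum>k. deriv0 f k / fact k * x ^ k) x" for x
      by (rule isCont_powser_converges_everywhere) (rule sums_summable[OF taylor])
    ultimately show ?thesis
      by (metis continuous_at_imp_continuous_on)
  qed
  have mgf: "has_bochner_integral N (\<lambda>x. exp (s * x + t * x)) (exp (1 / 2 * s\<^sup>2 + 1 * s * t + 1 / 2 * t\<^sup>2))" for s t
  proof (rule has_bochner_integral_nn_integral)
    have "(\<integral>\<^sup>+x. ennreal (exp (s * x + t * x)) \<partial>N)
        = (\<integral>\<^sup>+x. ennreal (1 / sqrt (2 * pi)) * ennreal (exp (- (1 * x\<^sup>2) / 2 + (s + t) * x)) \<partial>lborel)"
      unfolding N_def
      by (subst nn_integral_density)
         (auto simp: std_normal_density_def algebra_simps simp flip: ennreal_mult exp_add intro!: nn_integral_cong)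
    also have "\<dots> = ennreal (1 / sqrt (2 * pi)) * ennreal (sqrt (2 * pi / 1) * exp ((s + t)\<^sup>2 / (2 * 1)))"
      by (subst nn_integral_cmult) (simp_all only: nn_integral_exp_quadratic[of 1 "s + t"] zero_less_one, measurable)
    also have "\<dots> = ennreal (exp (1 / 2 * s\<^sup>2 + 1 * s * t + 1 / 2 * t\<^sup>2))"
      by (simp add: power2_sum field_simps flip: ennreal_mult)
    finally show "(\<integral>\<^sup>+x. ennreal (exp (s * x + t * x)) \<partial>N)
        = ennreal (exp (1 / 2 * s\<^sup>2 + 1 * s * t + 1 / 2 * t\<^sup>2))" .
  qed (auto simp: N_def)
  have id: "(\<lambda>x. x) \<in> borel_measurable N"
    by (simp add: N_def)
  note pair = expectation_pair[OF id id, of 1 1 1 f M,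
      OF integrable.intros[OF mgf] has_bochner_integral_integral_eq[OF mgf] taylor bound]
  have kf: "kappa f = (\<integral>x. f x * f x \<partial>N)"
    unfolding kappa_eq_pair_expectation[OF odd taylor bound] using pair(2) by simp
  have "kappa f \<ge> 0"
    unfolding kf by (intro integral_nonneg_AE) simp
  moreover have "kappa f \<noteq> 0"
  proof
    assume "kappa f = 0"
    then have "AE x in N. f x * f x = 0"
      using integral_nonneg_eq_0_iff_AE[OF pair(1)] kf by simp
    then have "AE x in lborel. f x = 0"
      unfolding N_def by (subst (asm) AE_density) (auto simp: normal_density_pos)
    then have ae: "AE x in lborel. x \<notin> {x. f x \<noteq> 0}" by simp
    have op: "open {x. f x \<noteq> 0}"
      using cont by (intro open_Collect_neq continuous_on_const)
    then have "{x. f x \<noteq> 0} \<in> null_sets lborel"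
      using ae by (subst AE_iff_null_sets) simp_all
    then have "negligible {x. f x \<noteq> 0}"
      by (simp add: negligible_iff_null_sets null_sets_completionI)
    with op show False
      using open_not_negligible nz by blast
  qed
  ultimately show ?thesis by simp
qed

lemma inverse_symmetric:
  fixes S P :: "real mat"
  assumes S: "S \<in> carrier_mat d d" and P: "P \<in> carrier_mat d d"
    and SP: "S * P = 1\<^sub>m d" and PS: "P * S = 1\<^sub>m d" and sym: "transpose_mat P = P"
  shows "transpose_mat S = S"
proof -
  have St: "transpose_mat S \<in> carrier_mat d d" using S by simp
  have "transpose_mat S * P = 1\<^sub>m d"
    using transpose_mult[OF P S] sym PS by simp
  then have "S = (transpose_mat S * P) * S" using S by simp
  also have "\<dots> = transpose_mat S * (P * S)" by (rule assoc_mult_mat[OF St P S])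
  finally show ?thesis using PS St by simp
qed

lemma one_plus_positive_definite:
  assumes B: "op_bound d B \<delta>" and \<delta>: "\<delta> < 1" and v: "v \<in> carrier_vec d" "v \<noteq> 0\<^sub>v d"
  shows "0 < scalar_prod v ((1\<^sub>m d + B) *\<^sub>v v)"
proof -
  note Bc = op_boundD(1)[OF B]
  have Bv: "B *\<^sub>v v \<in> carrier_vec d" using Bc v by simp
  have pos: "0 < euclid_norm v"
    using v euclid_norm_eq_0 euclid_norm_nonneg by (metis order_le_less)
  have "(1\<^sub>m d + B) *\<^sub>v v = v + B *\<^sub>v v"
    unfolding add_mult_distrib_mat_vec[OF one_carrier_mat Bc v(1)] using v by simp
  then have "scalar_prod v ((1\<^sub>m d + B) *\<^sub>v v) = (euclid_norm v)\<^sup>2 + scalar_prod v (B *\<^sub>v v)"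
    using scalar_prod_add_distrib[OF v(1) v(1) Bv] by (simp add: scalar_prod_self)
  moreover have "\<bar>scalar_prod v (B *\<^sub>v v)\<bar> \<le> euclid_norm v * (\<delta> * euclid_norm v)"
    using abs_scalar_prod_le[OF v(1) Bv] mult_left_mono[OF op_boundD(2)[OF B v(1)] euclid_norm_nonneg]
    by (rule order_trans)
  moreover have "0 < (1 - \<delta>) * (euclid_norm v)\<^sup>2"
    using \<delta> pos by simp
  ultimately show ?thesis
    by (simp add: power2_eq_square algebra_simps abs_le_iff)
qed

lemma tau_entry:
  fixes f :: "real \<Rightarrow> real"
  assumes taylor: "\<And>x. (\<lambda>k. deriv0 f k / fact k * x ^ k) sums f x"
    and bound: "\<And>k. \<bar>deriv0 f k\<bar> \<le> M"
    and S: "S \<in> carrier_mat d d" and inv: "mat_inverse S = Some P"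
    and sym: "transpose_mat P = P"
    and pd: "\<And>v. v \<in> carrier_vec d \<Longrightarrow> v \<noteq> 0\<^sub>v d \<Longrightarrow> 0 < scalar_prod v (P *\<^sub>v v)"
    and i: "i < d" and j: "j < d"
  shows "tau f d S $$ (i, j) = pair_expectation f (S $$ (i, i)) (S $$ (i, j)) (S $$ (j, j))"
proof -
  have PS: "S * P = 1\<^sub>m d" "P * S = 1\<^sub>m d" and P: "P \<in> carrier_mat d d"
    using mat_inverse(2)[OF S inv] by auto
  have Ssym: "S $$ (i, j) = S $$ (j, i)"
    using arg_cong[OF inverse_symmetric[OF S P PS sym], of "\<lambda>A. A $$ (j, i)"] S i j by simp
  have mgf: "has_bochner_integral (gaussian d S) (\<lambda>x. exp (s * x i + t * x j))
    (exp (S $$ (i, i) / 2 * s\<^sup>2 + S $$ (i, j) * s * t + S $$ (j, j) / 2 * t\<^sup>2))" for s t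
    by (rule gaussian_exp_pair[OF S inv sym _ Ssym i j]) (rule pd)
  have "(\<lambda>x. x k) \<in> borel_measurable (gaussian d S)" if "k < d" for k
    using that by (simp add: gaussian_def)
  from expectation_pair(2)[OF this[OF i] this[OF j]
      integrable.intros[OF mgf] has_bochner_integral_integral_eq[OF mgf] taylor bound]
  show ?thesis using i j by (simp add: tau_def)
qed

text \<open>
  With \<open>S = (I + B)\<^sup>-\<^sup>1 = I - B + O(\<epsilon>\<^sup>2)\<close> the variances are \<open>1 + O(\<epsilon>\<^sup>2)\<close>, because \<open>B\<close> has zero
  diagonal, and the covariances are \<open>- B $$ (i, j) + O(\<epsilon>\<^sup>2)\<close>.
\<close>
lemma tau_expansion:
  fixes f :: "real \<Rightarrow> real" and M
  assumes odd: "\<And>x. f (- x) = - f x"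
    and taylor: "\<And>x. (\<lambda>k. deriv0 f k / fact k * x ^ k) sums f x"
    and bound: "\<And>k. \<bar>deriv0 f k\<bar> \<le> M"
    and S: "S \<in> carrier_mat d d" and inv: "mat_inverse S = Some (1\<^sub>m d + B)"
    and B: "op_bound d B \<delta>" and sym: "transpose_mat B = B" and B0: "\<And>i. i < d \<Longrightarrow> B $$ (i, i) = 0"
    and \<delta>: "0 \<le> \<delta>" "\<delta> < 1" and \<epsilon>: "\<epsilon> = \<delta> / (1 - \<delta>)" "\<epsilon> \<le> 1"
    and i: "i < d" and j: "j < d"
  defines "C \<equiv> (M * exp 1)\<^sup>2 * (exp 4 + exp 1) + (M * exp 1)\<^sup>2 * (2 + exp 1) + lam f"
  shows "\<bar>tau f d S $$ (i, j) - kappa f * 1\<^sub>m d $$ (i, j) + lam f * B $$ (i, j)\<bar> \<le> C * \<epsilon>\<^sup>2"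
proof -
  note Bc = op_boundD(1)[OF B]
  have \<epsilon>0: "0 \<le> \<epsilon>" using \<delta> \<epsilon> by simp
  have \<epsilon>2: "\<delta>\<^sup>2 / (1 - \<delta>) \<le> \<epsilon>\<^sup>2"
  proof -
    have "\<delta>\<^sup>2 / (1 - \<delta>) = \<delta> * \<epsilon>" by (simp add: \<epsilon> power2_eq_square)
    also have "\<delta> \<le> \<epsilon>" using \<delta> by (simp add: \<epsilon> field_simps)
    then have "\<delta> * \<epsilon> \<le> \<epsilon> * \<epsilon>" using \<epsilon>0 by (rule mult_right_mono)
    finally show ?thesis by (simp add: power2_eq_square)
  qed
  have Psym: "transpose_mat (1\<^sub>m d + B) = 1\<^sub>m d + B"
    using transpose_add[OF one_carrier_mat Bc] sym by simp
  have tau: "tau f d S $$ (i, j) = pair_expectation f (S $$ (i, i)) (S $$ (i, j)) (S $$ (j, j))"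
    by (rule tau_entry[OF taylor bound S inv Psym _ i j]) (rule one_plus_positive_definite[OF B \<delta>(2)])
  have mB: "op_bound d (- B) \<delta>"
  proof -
    have "- B = (- 1) \<cdot>\<^sub>m B" using Bc by (intro eq_matI) auto
    then show ?thesis using op_bound_smult[OF B, of "- 1"] by simp
  qed
  have "1\<^sub>m d - (- B) = 1\<^sub>m d + B"
    using Bc by (intro eq_matI) auto
  then have PS: "(1\<^sub>m d - (- B)) * S = 1\<^sub>m d"
    using mat_inverse(2)[OF S inv] by simp
  have S1: "\<bar>S $$ (k, l) - 1\<^sub>m d $$ (k, l)\<bar> \<le> \<epsilon>"
    and S2: "\<bar>S $$ (k, l) - 1\<^sub>m d $$ (k, l) + B $$ (k, l)\<bar> \<le> \<epsilon>\<^sup>2" if "k < d" "l < d" for k l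
    using Neumann_estimates[OF mB \<delta> S PS that] \<epsilon>2 that Bc by (auto simp: \<epsilon>(1))
  have \<epsilon>sq: "\<epsilon>\<^sup>2 \<le> 1" using \<epsilon> \<epsilon>0 by (simp add: power_le_one)
  have Sd: "\<bar>S $$ (k, k) - 1\<bar> \<le> \<epsilon>\<^sup>2" if "k < d" for k
    using S2[of k k] that B0 by simp
  define L where "L = (M * exp 1)\<^sup>2"
  have L0: "0 \<le> L" by (simp add: L_def)
  have lam0: "0 \<le> lam f" by (simp add: lam_def)
  show ?thesis
  proof (cases "i = j")
    case True
    have tau': "tau f d S $$ (i, j) = pair_expectation f (S $$ (i, i)) (S $$ (i, i)) (S $$ (i, i))"
      using tau True by simp
    have "\<bar>S $$ (i, i) - 1\<bar> \<le> 1" using Sd[OF i] \<epsilon>sq by linarith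
    from pair_expectation_diagonal[OF bound this]
    have "\<bar>tau f d S $$ (i, j) - kappa f\<bar> \<le> L * (exp 4 + exp 1) * \<bar>S $$ (i, i) - 1\<bar>"
      by (simp only: tau' kappa_eq_pair_expectation[OF odd taylor bound] L_def)
    also have "\<dots> \<le> L * (exp 4 + exp 1) * \<epsilon>\<^sup>2"
      by (intro mult_left_mono Sd i mult_nonneg_nonneg L0) simp
    also have "\<dots> \<le> C * \<epsilon>\<^sup>2"
      unfolding C_def L_def[symmetric] using L0 lam0 by (intro mult_right_mono) auto
    finally show ?thesis using True i B0 by simp
  next
    case False
    then have one: "1\<^sub>m d $$ (i, j) = (0 :: real)" using i j by simp
    have s: "\<bar>S $$ (i, j)\<bar> \<le> \<epsilon>" using S1[OF i j] one by simp
    have "\<bar>S $$ (i, i) - 1\<bar> \<le> 1" "\<bar>S $$ (j, j) - 1\<bar> \<le> 1" "\<bar>S $$ (i, j)\<bar> \<le> 1"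
      using Sd[OF i] Sd[OF j] \<epsilon>sq s \<epsilon>(2) by linarith+
    from pair_expectation_off_diagonal[OF odd taylor bound this]
    have "\<bar>tau f d S $$ (i, j) - lam f * S $$ (i, j)\<bar> \<le> L * (\<bar>S $$ (i, j)\<bar> *
        (\<bar>S $$ (i, i) - 1\<bar> + \<bar>S $$ (j, j) - 1\<bar>) + (S $$ (i, j))\<^sup>2 * exp 1)"
      by (simp only: tau L_def)
    also have "\<dots> \<le> L * (1 * (\<epsilon>\<^sup>2 + \<epsilon>\<^sup>2) + \<epsilon>\<^sup>2 * exp 1)"
    proof (intro mult_left_mono add_mono mult_mono Sd i j L0 mult_right_mono)
      show "(S $$ (i, j))\<^sup>2 \<le> \<epsilon>\<^sup>2" using power_mono[OF s, of 2] by simp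
    qed (use s \<epsilon>(2) in auto)
    finally have 1: "\<bar>tau f d S $$ (i, j) - lam f * S $$ (i, j)\<bar> \<le> L * (2 + exp 1) * \<epsilon>\<^sup>2"
      by (simp add: algebra_simps)
    have 2: "\<bar>lam f * S $$ (i, j) + lam f * B $$ (i, j)\<bar> \<le> lam f * \<epsilon>\<^sup>2"
      using mult_left_mono[OF S2[OF i j] lam0] one lam0 by (simp add: abs_mult flip: distrib_left)
    have "0 \<le> L * (exp 4 + exp 1) * \<epsilon>\<^sup>2" using L0 by simp
    with 1 2 have "\<bar>tau f d S $$ (i, j) + lam f * B $$ (i, j)\<bar>
        \<le> L * (exp 4 + exp 1) * \<epsilon>\<^sup>2 + L * (2 + exp 1) * \<epsilon>\<^sup>2 + lam f * \<epsilon>\<^sup>2"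
      by linarith
    then show ?thesis
      unfolding one C_def L_def[symmetric] by (simp add: algebra_simps)
  qed
qed

text \<open>
  Writing \<open>U = \<kappa> (I - A)\<close>, the matrix \<open>A\<close> is \<open>(\<mu> / \<kappa>) B\<close> up to entries \<open>O(\<epsilon>\<^sup>2)\<close>. These entries
  have operator norm \<open>O(d * \<epsilon>\<^sup>2) = O(\<epsilon>)\<close>, so \<open>\<parallel>A\<parallel> \<le> q * \<epsilon>\<close> and the second order Neumann
  remainder is again \<open>O(\<epsilon>\<^sup>2)\<close> in every entry.
\<close>
lemma inverse_expansion:
  fixes U B :: "real mat"
  assumes U: "U \<in> carrier_mat d d" and B: "op_bound d B \<delta>" and \<delta>: "0 \<le> \<delta>" "\<delta> \<le> \<epsilon>"
    and k: "\<kappa> > 0" and l: "\<mu> \<ge> 0" and C: "C \<ge> 0" and \<epsilon>K: "real d * \<epsilon> \<le> K" "K > 0"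
    and U_exp: "\<And>i j. i < d \<Longrightarrow> j < d \<Longrightarrow>
       \<bar>U $$ (i, j) - \<kappa> * 1\<^sub>m d $$ (i, j) + \<mu> * B $$ (i, j)\<bar> \<le> C * \<epsilon>\<^sup>2"
  defines "q \<equiv> (\<mu> + C * K) / \<kappa>"
  assumes q: "q * \<epsilon> \<le> 1 / 2"
  shows "\<exists>T \<in> carrier_mat d d. mat_inverse U = Some T \<and>
    (\<forall>i<d. \<forall>j<d. \<bar>\<kappa> * T $$ (i, j) - 1\<^sub>m d $$ (i, j) - \<mu> / \<kappa> * B $$ (i, j)\<bar>
       \<le> (C / \<kappa> + 2 * q\<^sup>2) * \<epsilon>\<^sup>2)"
proof -
  note Bc = op_boundD(1)[OF B]
  have \<epsilon>: "0 \<le> \<epsilon>" using \<delta> by linarith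
  have q0: "0 \<le> q" using k l C \<epsilon>K by (simp add: q_def)
  define G where "G = Matrix.mat d d (\<lambda>(i, j). U $$ (i, j) - \<kappa> * 1\<^sub>m d $$ (i, j) + \<mu> * B $$ (i, j))"
  define A where "A = (\<mu> / \<kappa>) \<cdot>\<^sub>m B + (- 1 / \<kappa>) \<cdot>\<^sub>m G"
  have Gc: "G \<in> carrier_mat d d" by (simp add: G_def)
  have G: "op_bound d G (real d * (C * \<epsilon>\<^sup>2))"
    by (rule op_bound_of_entries[OF Gc]) (use U_exp C in \<open>auto simp: G_def\<close>)
  have A: "op_bound d A (q * \<epsilon>)"
  proof (rule op_bound_mono)
    show "op_bound d A (\<bar>\<mu> / \<kappa>\<bar> * \<delta> + \<bar>- 1 / \<kappa>\<bar> * (real d * (C * \<epsilon>\<^sup>2)))"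
      unfolding A_def by (intro op_bound_add op_bound_smult B G)
    have "C * \<epsilon> * (real d * \<epsilon>) \<le> C * \<epsilon> * K"
      using C \<epsilon> \<epsilon>K by (intro mult_left_mono) auto
    moreover have "\<mu> * \<delta> \<le> \<mu> * \<epsilon>"
      using l \<delta> by (intro mult_left_mono) auto
    ultimately have "(\<mu> * \<delta> + C * \<epsilon> * (real d * \<epsilon>)) / \<kappa> \<le> (\<mu> * \<epsilon> + C * \<epsilon> * K) / \<kappa>"
      using k by (intro divide_right_mono add_mono) auto
    then show "\<bar>\<mu> / \<kappa>\<bar> * \<delta> + \<bar>- 1 / \<kappa>\<bar> * (real d * (C * \<epsilon>\<^sup>2)) \<le> q * \<epsilon>"
      using k l by (simp add: q_def power2_eq_square add_divide_distrib algebra_simps)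
  qed
  note Ac = op_boundD(1)[OF A]
  have q1: "q * \<epsilon> < 1" using q by simp
  obtain N where N: "N \<in> carrier_mat d d" "(1\<^sub>m d - A) * N = 1\<^sub>m d" "N * (1\<^sub>m d - A) = 1\<^sub>m d"
    by (rule op_bound_imp_invertible[OF A q1])
  have UA: "U = \<kappa> \<cdot>\<^sub>m (1\<^sub>m d - A)"
    unfolding A_def G_def using U Bc k by (intro eq_matI) (auto simp: field_simps)
  have D: "1\<^sub>m d - A \<in> carrier_mat d d" by (rule minus_carrier_mat[OF Ac])
  define T where "T = (1 / \<kappa>) \<cdot>\<^sub>m N"
  have Tc: "T \<in> carrier_mat d d" using N by (simp add: T_def)
  have "mat_inverse U = Some T"
  proof (rule mat_inverse_SomeI[OF U Tc])
    have Dk: "\<kappa> \<cdot>\<^sub>m (1\<^sub>m d - A) \<in> carrier_mat d d" using D by simp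
    have "U * T = (1 / \<kappa>) \<cdot>\<^sub>m (\<kappa> \<cdot>\<^sub>m ((1\<^sub>m d - A) * N))"
      unfolding UA T_def mult_smult_distrib[OF Dk N(1)] mult_smult_assoc_mat[OF D N(1)] ..
    then show "U * T = 1\<^sub>m d" unfolding N(2) using k by (intro eq_matI) auto
    have "T * U = \<kappa> \<cdot>\<^sub>m ((1 / \<kappa>) \<cdot>\<^sub>m (N * (1\<^sub>m d - A)))"
      unfolding UA mult_smult_distrib[OF Tc D] unfolding T_def mult_smult_assoc_mat[OF N(1) D] ..
    then show "T * U = 1\<^sub>m d" unfolding N(3) using k by (intro eq_matI) auto
  qed
  moreover have "\<bar>\<kappa> * T $$ (i, j) - 1\<^sub>m d $$ (i, j) - \<mu> / \<kappa> * B $$ (i, j)\<bar> \<le> (C / \<kappa> + 2 * q\<^sup>2) * \<epsilon>\<^sup>2"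
    if i: "i < d" and j: "j < d" for i j
  proof -
    have "\<kappa> * T $$ (i, j) = N $$ (i, j)"
      using k i j N by (simp add: T_def)
    moreover have "A $$ (i, j) = \<mu> / \<kappa> * B $$ (i, j) - G $$ (i, j) / \<kappa>"
      using i j Bc Gc by (simp add: A_def)
    moreover have "\<bar>N $$ (i, j) - 1\<^sub>m d $$ (i, j) - A $$ (i, j)\<bar> \<le> (q * \<epsilon>)\<^sup>2 / (1 - q * \<epsilon>)"
      using q0 \<epsilon> by (intro Neumann_estimates(2)[OF A _ q1 N(1,2) i j]) simp
    moreover have "(q * \<epsilon>)\<^sup>2 / (1 - q * \<epsilon>) \<le> (q * \<epsilon>)\<^sup>2 / (1 / 2)"
      using q by (intro divide_left_mono) auto
    moreover have "\<bar>G $$ (i, j) / \<kappa>\<bar> \<le> C * \<epsilon>\<^sup>2 / \<kappa>"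
      unfolding abs_divide using U_exp[OF i j] i j k by (simp add: G_def divide_right_mono)
    ultimately have "\<bar>\<kappa> * T $$ (i, j) - 1\<^sub>m d $$ (i, j) - \<mu> / \<kappa> * B $$ (i, j)\<bar>
        \<le> C * \<epsilon>\<^sup>2 / \<kappa> + (q * \<epsilon>)\<^sup>2 / (1 / 2)"
      by linarith
    then show ?thesis
      by (simp add: power_mult_distrib algebra_simps)
  qed
  ultimately show ?thesis using Tc by blast
qed

theorem mainTheorem2:
  fixes f :: "real \<Rightarrow> real"
  assumes f_odd: "\<forall>x. f (- x) = - f x"
    and f_nonzero: "\<exists>x. f x \<noteq> 0"
    and f_taylor: "\<forall>x. (\<lambda>k. deriv0 f k / fact k * x ^ k) sums f x"
    and f_bounded: "bdd_above (range (\<lambda>k. \<bar>deriv0 f k\<bar>))"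
  shows "\<forall>K::real. K > 0 \<longrightarrow> (\<exists>C \<epsilon>0 :: real. C > 0 \<and> \<epsilon>0 > 0 \<and>
    (\<forall>(d::nat) (B::real mat) (S::real mat) (\<delta>::real) (\<epsilon>::real).
       d \<ge> 1 \<and>
       B \<in> carrier_mat d d \<and> transpose_mat B = B \<and> (\<forall>i<d. B $$ (i, i) = 0) \<and>
       op_norm B \<le> \<delta> \<and> \<delta> < 1 \<and> \<epsilon> = \<delta> / (1 - \<delta>) \<and>
       S \<in> carrier_mat d d \<and> mat_inverse S = Some (1\<^sub>m d + B) \<and>
       real d * \<epsilon> \<le> K \<and> \<epsilon> \<le> \<epsilon>0
       \<longrightarrow>
       (\<exists>T \<in> carrier_mat d d. \<exists>E \<in> carrier_mat d d.
          mat_inverse (tau f d S) = Some T \<and>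
          T = (1 / kappa f) \<cdot>\<^sub>m 1\<^sub>m d + (lam f / (kappa f)\<^sup>2) \<cdot>\<^sub>m B + (1 / kappa f) \<cdot>\<^sub>m E \<and>
          (\<forall>i<d. \<forall>j<d. i \<noteq> j \<longrightarrow> \<bar>E $$ (i, j)\<bar> \<le> C * \<epsilon>\<^sup>2) \<and>
          (\<forall>i<d. \<forall>j<d. i \<noteq> j \<and> B $$ (i, j) = 0 \<longrightarrow> \<bar>T $$ (i, j)\<bar> \<le> C * \<epsilon>\<^sup>2) \<and>
          (\<forall>i<d. \<forall>j<d. i \<noteq> j \<and> B $$ (i, j) \<noteq> 0 \<longrightarrow>
             \<bar>T $$ (i, j) - lam f / (kappa f)\<^sup>2 * B $$ (i, j)\<bar> \<le> C * \<epsilon>\<^sup>2))))"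
proof (intro allI impI)
  fix K :: real assume K: "K > 0"
  obtain M where bound: "\<And>k. \<bar>deriv0 f k\<bar> \<le> M"
    using f_bounded by (auto simp: bdd_above_def)
  have odd: "\<And>x. f (- x) = - f x" and taylor: "\<And>x. (\<lambda>k. deriv0 f k / fact k * x ^ k) sums f x"
    using f_odd f_taylor by auto
  have kappa: "kappa f > 0"
    using f_nonzero kappa_pos[OF odd taylor bound] by blast
  have lam0: "lam f \<ge> 0" by (simp add: lam_def)
  define C1 where "C1 = (M * exp 1)\<^sup>2 * (exp 4 + exp 1) + (M * exp 1)\<^sup>2 * (2 + exp 1) + lam f"
  have C1: "C1 \<ge> 0"
    unfolding C1_def using lam0 by (intro add_nonneg_nonneg mult_nonneg_nonneg) auto
  define q where "q = (lam f + C1 * K) / kappa f"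
  have q0: "q \<ge> 0" using lam0 C1 K kappa by (simp add: q_def)
  define C2 where "C2 = C1 / kappa f + 2 * q\<^sup>2"
  have C2: "C2 \<ge> 0" using C1 kappa by (simp add: C2_def)
  define C where "C = C2 + C2 / kappa f + 1"
  \<comment> \<open>This choice gives \<open>q * \<epsilon> \<le> 1 / 2\<close>, which bounds the inverse of \<open>I - A\<close> by 2.\<close>
  define \<epsilon>0 where "\<epsilon>0 = min 1 (1 / (2 * q + 1))"
  have Ccmp: "C > 0" "C2 \<le> C" "C2 / kappa f \<le> C"
    using C2 kappa by (auto simp: C_def add_pos_nonneg intro: add_nonneg_pos)
  have \<epsilon>0: "\<epsilon>0 > 0" "\<epsilon>0 \<le> 1" using q0 by (auto simp: \<epsilon>0_def)
  show "\<exists>C \<epsilon>0 :: real. C > 0 \<and> \<epsilon>0 > 0 \<and>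
    (\<forall>(d::nat) (B::real mat) (S::real mat) (\<delta>::real) (\<epsilon>::real).
       d \<ge> 1 \<and>
       B \<in> carrier_mat d d \<and> transpose_mat B = B \<and> (\<forall>i<d. B $$ (i, i) = 0) \<and>
       op_norm B \<le> \<delta> \<and> \<delta> < 1 \<and> \<epsilon> = \<delta> / (1 - \<delta>) \<and>
       S \<in> carrier_mat d d \<and> mat_inverse S = Some (1\<^sub>m d + B) \<and>
       real d * \<epsilon> \<le> K \<and> \<epsilon> \<le> \<epsilon>0
       \<longrightarrow>
       (\<exists>T \<in> carrier_mat d d. \<exists>E \<in> carrier_mat d d.
          mat_inverse (tau f d S) = Some T \<and>
          T = (1 / kappa f) \<cdot>\<^sub>m 1\<^sub>m d + (lam f / (kappa f)\<^sup>2) \<cdot>\<^sub>m B + (1 / kappa f) \<cdot>\<^sub>m E \<and>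
          (\<forall>i<d. \<forall>j<d. i \<noteq> j \<longrightarrow> \<bar>E $$ (i, j)\<bar> \<le> C * \<epsilon>\<^sup>2) \<and>
          (\<forall>i<d. \<forall>j<d. i \<noteq> j \<and> B $$ (i, j) = 0 \<longrightarrow> \<bar>T $$ (i, j)\<bar> \<le> C * \<epsilon>\<^sup>2) \<and>
          (\<forall>i<d. \<forall>j<d. i \<noteq> j \<and> B $$ (i, j) \<noteq> 0 \<longrightarrow>
             \<bar>T $$ (i, j) - lam f / (kappa f)\<^sup>2 * B $$ (i, j)\<bar> \<le> C * \<epsilon>\<^sup>2)))"
  proof (rule exI[of _ C], rule exI[of _ \<epsilon>0], intro conjI allI impI Ccmp(1) \<epsilon>0(1))
    fix d :: nat and B S :: "real mat" and \<delta> \<epsilon> :: real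
    assume asm: "d \<ge> 1 \<and>
       B \<in> carrier_mat d d \<and> transpose_mat B = B \<and> (\<forall>i<d. B $$ (i, i) = 0) \<and>
       op_norm B \<le> \<delta> \<and> \<delta> < 1 \<and> \<epsilon> = \<delta> / (1 - \<delta>) \<and>
       S \<in> carrier_mat d d \<and> mat_inverse S = Some (1\<^sub>m d + B) \<and>
       real d * \<epsilon> \<le> K \<and> \<epsilon> \<le> \<epsilon>0"
    then have Bc: "B \<in> carrier_mat d d" by simp
    have B: "op_bound d B \<delta>"
      using asm op_bound_mono[OF op_bound_op_norm[OF Bc]] by simp
    have \<delta>: "0 \<le> \<delta>" "\<delta> < 1"
      using op_bound_entry[OF B, of 0 0] asm by auto
    have "\<epsilon> = \<delta> / (1 - \<delta>)" using asm by simp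
    then have \<delta>\<epsilon>: "\<delta> \<le> \<epsilon>" using \<delta> by (simp add: pos_le_divide_eq mult_left_le)
    have "\<epsilon> \<le> \<epsilon>0" using asm by blast
    with \<epsilon>0(2) have \<epsilon>1: "\<epsilon> \<le> 1" by linarith
    have q\<epsilon>: "q * \<epsilon> \<le> 1 / 2"
    proof -
      have "q * \<epsilon> \<le> q * (1 / (2 * q + 1))"
        using asm q0 by (intro mult_left_mono) (auto simp: \<epsilon>0_def)
      also have "\<dots> \<le> 1 / 2" using q0 by (simp add: field_simps)
      finally show ?thesis .
    qed
    have tauc: "tau f d S \<in> carrier_mat d d" by (simp add: tau_def)
    have tau_exp: "\<bar>tau f d S $$ (i, j) - kappa f * 1\<^sub>m d $$ (i, j) + lam f * B $$ (i, j)\<bar> \<le> C1 * \<epsilon>\<^sup>2"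
      if "i < d" "j < d" for i j
      unfolding C1_def using asm \<delta> \<epsilon>1 that
      by (intro tau_expansion[OF odd taylor bound _ _ B]) auto
    have d\<epsilon>: "real d * \<epsilon> \<le> K" using asm by blast
    have "\<exists>T \<in> carrier_mat d d. mat_inverse (tau f d S) = Some T \<and>
      (\<forall>i<d. \<forall>j<d. \<bar>kappa f * T $$ (i, j) - 1\<^sub>m d $$ (i, j) - lam f / kappa f * B $$ (i, j)\<bar>
         \<le> C2 * \<epsilon>\<^sup>2)"
      unfolding C2_def q_def
    proof (rule inverse_expansion[OF tauc B \<delta>(1) \<delta>\<epsilon> kappa lam0 C1 d\<epsilon> K])
      show "(lam f + C1 * K) / kappa f * \<epsilon> \<le> 1 / 2"
        using q\<epsilon> unfolding q_def .
    qed (rule tau_exp)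
    then obtain T where T: "T \<in> carrier_mat d d" "mat_inverse (tau f d S) = Some T"
      and T_exp: "\<And>i j. i < d \<Longrightarrow> j < d \<Longrightarrow>
        \<bar>kappa f * T $$ (i, j) - 1\<^sub>m d $$ (i, j) - lam f / kappa f * B $$ (i, j)\<bar> \<le> C2 * \<epsilon>\<^sup>2"
      by blast
    define E where "E = Matrix.mat d d (\<lambda>(i, j). kappa f * T $$ (i, j) - 1\<^sub>m d $$ (i, j) - lam f / kappa f * B $$ (i, j))"
    have E: "\<bar>E $$ (i, j)\<bar> \<le> C2 * \<epsilon>\<^sup>2" if "i < d" "j < d" for i j
      using T_exp[OF that] that by (simp add: E_def)
    have T_off: "\<bar>T $$ (i, j) - lam f / (kappa f)\<^sup>2 * B $$ (i, j)\<bar> \<le> C * \<epsilon>\<^sup>2"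
      if "i < d" "j < d" "i \<noteq> j" for i j
    proof -
      have "T $$ (i, j) - lam f / (kappa f)\<^sup>2 * B $$ (i, j) = E $$ (i, j) / kappa f"
        using that kappa by (simp add: E_def field_simps power2_eq_square)
      also have "\<bar>\<dots>\<bar> \<le> C2 * \<epsilon>\<^sup>2 / kappa f"
        unfolding abs_divide using E[OF that(1,2)] kappa by (simp add: divide_right_mono)
      also have "\<dots> \<le> C * \<epsilon>\<^sup>2"
        using mult_right_mono[OF Ccmp(3), of "\<epsilon>\<^sup>2"] by simp
      finally show ?thesis .
    qed
    show "\<exists>T \<in> carrier_mat d d. \<exists>E \<in> carrier_mat d d.
          mat_inverse (tau f d S) = Some T \<and>
          T = (1 / kappa f) \<cdot>\<^sub>m 1\<^sub>m d + (lam f / (kappa f)\<^sup>2) \<cdot>\<^sub>m B + (1 / kappa f) \<cdot>\<^sub>m E \<and>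
          (\<forall>i<d. \<forall>j<d. i \<noteq> j \<longrightarrow> \<bar>E $$ (i, j)\<bar> \<le> C * \<epsilon>\<^sup>2) \<and>
          (\<forall>i<d. \<forall>j<d. i \<noteq> j \<and> B $$ (i, j) = 0 \<longrightarrow> \<bar>T $$ (i, j)\<bar> \<le> C * \<epsilon>\<^sup>2) \<and>
          (\<forall>i<d. \<forall>j<d. i \<noteq> j \<and> B $$ (i, j) \<noteq> 0 \<longrightarrow>
             \<bar>T $$ (i, j) - lam f / (kappa f)\<^sup>2 * B $$ (i, j)\<bar> \<le> C * \<epsilon>\<^sup>2)"
    proof (rule bexI[OF _ T(1)], rule bexI[of _ E], intro conjI allI impI T(2))
      show "E \<in> carrier_mat d d" by (simp add: E_def)
      show "T = (1 / kappa f) \<cdot>\<^sub>m 1\<^sub>m d + (lam f / (kappa f)\<^sup>2) \<cdot>\<^sub>m B + (1 / kappa f) \<cdot>\<^sub>m E"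
        using T(1) Bc kappa by (intro eq_matI) (auto simp: E_def field_simps power2_eq_square)
      show "\<bar>E $$ (i, j)\<bar> \<le> C * \<epsilon>\<^sup>2" if "i < d" "j < d" "i \<noteq> j" for i j
        using E[OF that(1,2)] mult_right_mono[OF Ccmp(2), of "\<epsilon>\<^sup>2"] by simp
      show "\<bar>T $$ (i, j)\<bar> \<le> C * \<epsilon>\<^sup>2" if "i < d" "j < d" "i \<noteq> j \<and> B $$ (i, j) = 0" for i j
        using T_off[OF that(1,2)] that(3) by simp
      show "\<bar>T $$ (i, j) - lam f / (kappa f)\<^sup>2 * B $$ (i, j)\<bar> \<le> C * \<epsilon>\<^sup>2"
        if "i < d" "j < d" "i \<noteq> j \<and> B $$ (i, j) \<noteq> 0" for i j
        using T_off[OF that(1,2)] that(3) by simp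
    qed
  qed
qed

end
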